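(* Let $A$ and $B$ be strictly positive operators on a Hilbert space $H$ such that $uA\le B\le vA$ for real numbers $u,v>0$, let $c\in\mathbb{R}$, and let $p,q\in[-1,1]\setminus\{0\}$. (A) If $0<c\le\frac12$, then $$T_p(A|B)-c\,S_p(A|B)\ \le\ T_q(A|B)-c\,S_q(A|B)$$ holds under any one of the following conditions: (a1) $u\ge1$ and $-1\le p\le q<0$; (a2) $v\le1$ and $0<p\le q\le1$; (b1) $1\le u\le v\le e^{\frac{1-2c}{cq}}$ and $0<p\le q\le 1$; (b2) $e^{\frac{1-2c}{cp}}\le u\le v\le 1$ and $-1\le p\le q<0$. (B) If $c\ge\frac12$, then $$T_p(A|B)-c\,S_p(A|B)\ \ge\ T_q(A|B)-c\,S_q(A|B)$$ holds under any one of the following conditions: (d1) $e^{\frac{1-2c}{cq}}\le u\le v\le1$ and $0<p\le q\le1$; (d2) $1\le u\le v\le e^{\frac{1-2c}{cp}}$ and $-1\le p\le q<0$; (e1) $u\ge1$ and $0<p\le q\le1$; (e2) $v\le 1$ and $-1\le p\le q<0$. (C) If $c\le0$ and $-1\le p\le q\le1$ with $p\ne0$, $q\neq0$, then $$T_p(A|B)-c\,S_p(A|B)\ \le\ T_q(A|B)-c\,S_q(A|B).$$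
   Context: An operator $A\in B(H)$ (bounded linear operators on a Hilbert space $H$) is strictly positive, $A>0$, if $A\ge 0$ and $A$ is invertible. For self-adjoint $X,Y$, $X\le Y$ means $Y-X$ is positive semidefinite. Powers and logarithms are taken by functional calculus. For $A,B>0$: - Generalized relative operator entropy, $r\in\mathbb{R}$: $S_r(A|B)=A^{1/2}(A^{-1/2}BA^{-1/2})^r\log(A^{-1/2}BA^{-1/2})A^{1/2}$. - Tsallis relative operator entropy, $p\in[-1,1]$, $p\ne0$: $T_p(A|B)=\dfrac{A^{1/2}(A^{-1/2}BA^{-1/2})^pA^{1/2}-A}{p}$. *)

theory Defs
  imports "HOL-Analysis.Analysis" "HOL-Computational_Algebra.Polynomial"
begin

class complex_vector = real_vector +
  fixes scaleC :: "complex \<Rightarrow> 'a \<Rightarrow> 'a" (infixr "*\<^sub>C" 75)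
  assumes scaleC_add_right: "z *\<^sub>C (x + y) = z *\<^sub>C x + z *\<^sub>C y"
    and scaleC_add_left: "(z + w) *\<^sub>C x = z *\<^sub>C x + w *\<^sub>C x"
    and scaleC_scaleC: "z *\<^sub>C (w *\<^sub>C x) = (z * w) *\<^sub>C x"
    and scaleR_scaleC: "r *\<^sub>R x = complex_of_real r *\<^sub>C x"

text \<open>The real part of a complex inner product is a real inner product inducing the same norm,
  so extending \<open>real_inner\<close> loses no generality. Definiteness and
  \<open>norm x = sqrt (Re (cinner x x))\<close> are inherited from \<open>real_inner\<close>.\<close>

class complex_inner = complex_vector + real_inner +
  fixes cinner :: "'a \<Rightarrow> 'a \<Rightarrow> complex"
  assumes cinner_commute: "cinner x y = cnj (cinner y x)"
    and cinner_add_left: "cinner (x + x') y = cinner x y + cinner x' y"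
    and cinner_scaleC_left: "cinner (z *\<^sub>C x) y = z * cinner x y"
    and inner_eq_Re_cinner: "inner x y = Re (cinner x y)"

class chilbert_space = complex_inner + banach

instantiation complex :: chilbert_space
begin

definition scaleC_complex :: "complex \<Rightarrow> complex \<Rightarrow> complex"
  where "scaleC_complex z x = z * x"

definition cinner_complex :: "complex \<Rightarrow> complex \<Rightarrow> complex"
  where "cinner_complex x y = x * cnj y"

instance
  by standard
    (simp_all add: scaleC_complex_def cinner_complex_def inner_complex_def algebra_simps
      scaleR_conv_of_real)

end

lemma cinner_self: "cinner x x = complex_of_real ((norm x)\<^sup>2)"
  for x :: "'a::complex_inner"
proof (rule complex_eqI)
  show "Re (cinner x x) = Re (complex_of_real ((norm x)\<^sup>2))"
    by (simp add: inner_eq_Re_cinner[symmetric] power2_norm_eq_inner)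
  have "Im (cinner x x) = - Im (cinner x x)"
    using arg_cong[where f = Im, OF cinner_commute[of x x]] by (simp only: cnj.sel)
  then show "Im (cinner x x) = Im (complex_of_real ((norm x)\<^sup>2))"
    by simp
qed

lemma norm_scaleC: "norm (z *\<^sub>C x) = cmod z * norm x"
  for x :: "'a::complex_inner"
proof -
  have "cinner (z *\<^sub>C x) (z *\<^sub>C x) = z * cnj z * cinner x x"
    by (metis cinner_commute cinner_scaleC_left complex_cnj_mult mult.assoc)
  then have "complex_of_real ((norm (z *\<^sub>C x))\<^sup>2) = complex_of_real ((cmod z * norm x)\<^sup>2)"
    by (simp add: cinner_self complex_norm_square[symmetric] power_mult_distrib
        flip: of_real_power of_real_mult)
  then have "(norm (z *\<^sub>C x))\<^sup>2 = (cmod z * norm x)\<^sup>2"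
    using of_real_eq_iff by blast
  then show ?thesis
    by (simp add: power2_eq_iff_nonneg)
qed

lemma bounded_linear_scaleC: "bounded_linear (\<lambda>x::'a::complex_inner. z *\<^sub>C x)"
  by (rule bounded_linear_intro[where K = "cmod z"])
    (simp_all add: scaleC_add_right scaleR_scaleC scaleC_scaleC norm_scaleC mult.commute)

text \<open>Elements of \<open>'a \<Rightarrow>\<^sub>L 'a\<close> are bounded and real-linear; \<open>B(H)\<close> consists
  of those that are in addition complex-linear. The operator norms coincide.\<close>

definition clinear_op :: "('a::chilbert_space \<Rightarrow>\<^sub>L 'a) \<Rightarrow> bool"
  where "clinear_op T \<longleftrightarrow> (\<forall>z x. T (z *\<^sub>C x) = z *\<^sub>C T x)"

definition scalar_op :: "complex \<Rightarrow> 'a::chilbert_space \<Rightarrow>\<^sub>L 'a"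
  where "scalar_op z = Blinfun (\<lambda>x. z *\<^sub>C x)"

lemma scalar_op_apply [simp]: "scalar_op z x = z *\<^sub>C x"
  by (simp add: scalar_op_def bounded_linear_Blinfun_apply bounded_linear_scaleC)

definition invertible_op :: "('a::chilbert_space \<Rightarrow>\<^sub>L 'a) \<Rightarrow> bool"
  where "invertible_op T \<longleftrightarrow>
    (\<exists>S. clinear_op S \<and> S o\<^sub>L T = id_blinfun \<and> T o\<^sub>L S = id_blinfun)"

definition positive_op :: "('a::chilbert_space \<Rightarrow>\<^sub>L 'a) \<Rightarrow> bool"
  where "positive_op T \<longleftrightarrow> clinear_op T \<and> (\<forall>x. cinner (T x) x \<in> \<real>\<^sub>\<ge>\<^sub>0)"

definition strictly_positive_op :: "('a::chilbert_space \<Rightarrow>\<^sub>L 'a) \<Rightarrow> bool"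
  where "strictly_positive_op T \<longleftrightarrow> positive_op T \<and> invertible_op T"

definition le_op :: "('a::chilbert_space \<Rightarrow>\<^sub>L 'a) \<Rightarrow> ('a \<Rightarrow>\<^sub>L 'a) \<Rightarrow> bool"
    (infix "\<le>\<^sub>H" 50)
  where "X \<le>\<^sub>H Y \<longleftrightarrow> positive_op (Y - X)"

definition spectrum_op :: "('a::chilbert_space \<Rightarrow>\<^sub>L 'a) \<Rightarrow> complex set"
  where "spectrum_op T = {z. \<not> invertible_op (T - scalar_op z)}"

definition poly_op :: "real poly \<Rightarrow> ('a::chilbert_space \<Rightarrow>\<^sub>L 'a) \<Rightarrow> 'a \<Rightarrow>\<^sub>L 'a"
  where "poly_op P T = (\<Sum>i\<le>degree P. coeff P i *\<^sub>R (((o\<^sub>L) T ^^ i) id_blinfun))"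

text \<open>Continuous functional calculus, for \<open>X\<close> self-adjoint (so that its spectrum is real and
  compact) and \<open>f\<close> real-valued and continuous on the spectrum: \<open>f(X)\<close> is the norm limit of
  \<open>P(X)\<close> as the polynomials \<open>P\<close> converge to \<open>f\<close> uniformly on the spectrum. Outside of this
  situation the value is unspecified. Only the values of \<open>f\<close> on the spectrum matter, so for
  strictly positive \<open>X\<close> the conventions for \<open>powr\<close> and \<open>ln\<close> on nonpositive numbers are
  irrelevant.\<close>

definition fun_calc :: "(real \<Rightarrow> real) \<Rightarrow> ('a::chilbert_space \<Rightarrow>\<^sub>L 'a) \<Rightarrow> 'a \<Rightarrow>\<^sub>L 'a"
  where "fun_calc f X = (THE Y. \<forall>\<epsilon>>0. \<exists>P.
    (\<forall>t. complex_of_real t \<in> spectrum_op X \<longrightarrow> \<bar>poly P t - f t\<bar> < \<epsilon>) \<and>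
    norm (poly_op P X - Y) < \<epsilon>)"

definition powr_op :: "('a::chilbert_space \<Rightarrow>\<^sub>L 'a) \<Rightarrow> real \<Rightarrow> 'a \<Rightarrow>\<^sub>L 'a"
  where "powr_op X r = fun_calc (\<lambda>t. t powr r) X"

definition ln_op :: "('a::chilbert_space \<Rightarrow>\<^sub>L 'a) \<Rightarrow> 'a \<Rightarrow>\<^sub>L 'a"
  where "ln_op X = fun_calc ln X"

definition rel_op :: "('a::chilbert_space \<Rightarrow>\<^sub>L 'a) \<Rightarrow> ('a \<Rightarrow>\<^sub>L 'a) \<Rightarrow> 'a \<Rightarrow>\<^sub>L 'a"
  where "rel_op A B = powr_op A (-1/2) o\<^sub>L B o\<^sub>L powr_op A (-1/2)"

definition rel_entropy :: "real \<Rightarrow> ('a::chilbert_space \<Rightarrow>\<^sub>L 'a) \<Rightarrow> ('a \<Rightarrow>\<^sub>L 'a) \<Rightarrow> 'a \<Rightarrow>\<^sub>L 'a"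
  where "rel_entropy r A B =
    powr_op A (1/2) o\<^sub>L powr_op (rel_op A B) r o\<^sub>L ln_op (rel_op A B) o\<^sub>L powr_op A (1/2)"

definition tsallis_entropy ::
    "real \<Rightarrow> ('a::chilbert_space \<Rightarrow>\<^sub>L 'a) \<Rightarrow> ('a \<Rightarrow>\<^sub>L 'a) \<Rightarrow> 'a \<Rightarrow>\<^sub>L 'a"
  where "tsallis_entropy p A B =
    ((powr_op A (1/2) o\<^sub>L powr_op (rel_op A B) p o\<^sub>L powr_op A (1/2)) - A) /\<^sub>R p"

end

theory Submission
  imports Defs "HOL-Computational_Algebra.Fundamental_Theorem_Algebra"
begin

text \<open>With \<open>R = A powr (1/2)\<close> and \<open>X = R\<inverse> B R\<inverse>\<close>, the operator \<open>T\<^sub>r - c S\<^sub>r\<close> is \<open>R f\<^sub>r(X) R\<close> for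
  \<open>f\<^sub>r(t) = (t powr r - 1) / r - c * (t powr r * ln t)\<close>, and the spectrum of \<open>X\<close> lies in \<open>[u, v]\<close>;
  so everything reduces to monotonicity of \<open>r \<mapsto> f\<^sub>r(t)\<close> for \<open>t \<in> [u, v]\<close>. For \<open>s = r * ln t\<close> the sign of the
  derivative is that of \<open>s - 1 + exp (- s) - c * s\<^sup>2\<close>, which is decided by the second-order Taylor
  bounds or by comparing \<open>exp (- s)\<close> with its Pade approximant \<open>(2 - s) / (2 + s)\<close>.

  The functional calculus preserves positivity because, if \<open>- a < 0\<close> is the greatest lower bound of the
  quadratic form of a self-adjoint \<open>P(X)\<close>, then \<open>P(X) + a\<close> is positive but not bounded below, hence
  not invertible, and a factorisation of \<open>P + a\<close> yields a spectral point of \<open>X\<close> where \<open>P = - a\<close>.\<close>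

section \<open>Scalar inequalities\<close>

text \<open>The derivative is \<open>1 - exp (- x) - x \<le> 0\<close>. The function vanishes at
  \<open>0\<close>, so comparison with \<open>0\<close> gives the sign of \<open>slope (1/2)\<close>
  on each half-line.\<close>

lemma exp_minus_quadratic_antimono:
  fixes s t :: real
  assumes "s \<le> t"
  shows "t - 1 + exp (- t) - t\<^sup>2 / 2 \<le> s - 1 + exp (- s) - s\<^sup>2 / 2"
proof (rule DERIV_nonpos_imp_nonincreasing[OF assms])
  fix x :: real
  have "((\<lambda>s. s - 1 + exp (- s) - s\<^sup>2 / 2) has_real_derivative 1 - exp (- x) - x) (at x)"
    by (auto intro!: derivative_eq_intros)
  moreover have "1 - exp (- x) - x \<le> 0"
    using exp_ge_add_one_self[of "- x"] by simp
  ultimately show "\<exists>y. ((\<lambda>s. s - 1 + exp (- s) - s\<^sup>2 / 2) has_real_derivative y) (at x) \<and> y \<le> 0"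
    by blast
qed

text \<open>The Pade bound with its denominator cleared: the value at \<open>0\<close> is
  \<open>2\<close>, so comparison with \<open>0\<close> yields
  \<open>exp (- s) * (2 + s) \<ge> 2 - s\<close> for \<open>s \<ge> 0\<close> and the reverse for
  \<open>s \<le> 0\<close>, whatever the sign of \<open>2 + s\<close>.\<close>

lemma exp_pade_mono:
  fixes s t :: real
  assumes "s \<le> t"
  shows "exp (- s) * (2 + s) + s \<le> exp (- t) * (2 + t) + t"
proof (rule DERIV_nonneg_imp_nondecreasing[OF assms])
  fix x :: real
  have "((\<lambda>s. exp (- s) * (2 + s) + s) has_real_derivative 1 - exp (- x) * (1 + x)) (at x)"
    by (auto intro!: derivative_eq_intros simp: algebra_simps)
  moreover have "exp (- x) * (1 + x) \<le> exp (- x) * exp x"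
    by (intro mult_left_mono exp_ge_add_one_self) simp
  then have "0 \<le> 1 - exp (- x) * (1 + x)"
    by (simp flip: exp_add)
  ultimately show "\<exists>y. ((\<lambda>s. exp (- s) * (2 + s) + s) has_real_derivative y) (at x) \<and> 0 \<le> y"
    by blast
qed

text \<open>Up to the positive factor \<open>exp s / r\<^sup>2\<close>, with \<open>s = r * ln t\<close>, the derivative in \<open>r\<close> of
  \<open>(t powr r - 1) / r - c * (t powr r * ln t)\<close>.\<close>

definition slope :: "real \<Rightarrow> real \<Rightarrow> real"
  where "slope c s = s - 1 + exp (- s) - c * s\<^sup>2"

text \<open>Since \<open>slope c s\<close> is nonincreasing in \<open>c\<close>, the case
  \<open>c = 1/2\<close> suffices, as it also does in
  \<open>slope_nonpos_nonneg_arg\<close>.\<close>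

lemma slope_nonneg_nonpos_arg: "c \<le> 1/2 \<Longrightarrow> s \<le> 0 \<Longrightarrow> 0 \<le> slope c s"
  using exp_minus_quadratic_antimono[of s 0] mult_right_mono[of c "1/2" "s\<^sup>2"]
  by (simp add: slope_def)

lemma slope_nonpos_nonneg_arg: "1/2 \<le> c \<Longrightarrow> 0 \<le> s \<Longrightarrow> slope c s \<le> 0"
  using exp_minus_quadratic_antimono[of 0 s] mult_right_mono[of "1/2" c "s\<^sup>2"]
  by (simp add: slope_def)

lemma slope_nonneg_nonpos_coeff: "c \<le> 0 \<Longrightarrow> 0 \<le> slope c s"
  using exp_ge_add_one_self[of "- s"] mult_right_mono[of c 0 "s\<^sup>2"]
  by (simp add: slope_def)

text \<open>For \<open>c > 0\<close> the second hypothesis reads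
  \<open>s \<le> (1 - 2 * c) / c\<close>, the threshold in the exponents of the theorem.\<close>

lemma slope_nonneg_nonneg_arg:
  assumes "0 \<le> s" "c * (s + 2) \<le> 1"
  shows "0 \<le> slope c s"
proof -
  \<comment> \<open>Multiplying by \<open>s + 2\<close> separates the Pade difference from a
    multiple of \<open>1 - c * (s + 2)\<close>, and each has a known sign.\<close>
  have "slope c s * (s + 2) = exp (- s) * (2 + s) + s - 2 + s\<^sup>2 * (1 - c * (s + 2))"
    by (simp add: slope_def algebra_simps power2_eq_square)
  also have "\<dots> \<ge> 0"
    using exp_pade_mono[of 0 s] assms by simp
  finally show ?thesis
    using assms(1) by (simp add: zero_le_mult_iff)
qed

lemma slope_nonpos_nonpos_arg:
  assumes "s \<le> 0" "1 \<le> c * (s + 2)" "0 < c"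
  shows "slope c s \<le> 0"
proof -
  have s: "0 < s + 2"
    using assms(2,3) zero_less_mult_pos[of c "s + 2"] by simp
  have "slope c s * (s + 2) = exp (- s) * (2 + s) + s - 2 + s\<^sup>2 * (1 - c * (s + 2))"
    by (simp add: slope_def algebra_simps power2_eq_square)
  also have "\<dots> \<le> 0"
    using exp_pade_mono[of s 0] assms mult_nonneg_nonpos[of "s\<^sup>2" "1 - c * (s + 2)"] by simp
  finally show ?thesis
    using s by (simp add: mult_le_0_iff)
qed

section \<open>Monotonicity of the scalar function in the entropy parameter\<close>

definition entropy_fun :: "real \<Rightarrow> real \<Rightarrow> real \<Rightarrow> real"
  where "entropy_fun c r t = (t powr r - 1) / r - c * (t powr r * ln t)"

lemma entropy_fun_exp:
  "0 < t \<Longrightarrow> entropy_fun c r t = (exp (r * ln t) - 1) / r - c * (exp (r * ln t) * ln t)"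
  by (simp add: entropy_fun_def powr_def)

lemma has_real_derivative_entropy_fun:
  assumes "0 < t" "r \<noteq> 0"
  shows "((\<lambda>r. entropy_fun c r t) has_real_derivative
    exp (r * ln t) / r\<^sup>2 * slope c (r * ln t)) (at r)"
proof -
  define x where "x = ln t"
  have "((\<lambda>r. (exp (r * x) - 1) / r - c * (exp (r * x) * x)) has_real_derivative
      (exp (r * x) * x * r - (exp (r * x) - 1)) / (r * r) - c * (exp (r * x) * x * x)) (at r)"
    using assms(2) by (auto intro!: derivative_eq_intros simp: algebra_simps)
  \<comment> \<open>The \<open>exp (- s)\<close> inside \<open>slope\<close> is absorbed by the
    prefactor \<open>exp s\<close>, for \<open>s = r * x\<close>.\<close>
  moreover have "exp (r * x) * exp (- (r * x)) = 1"
    by (simp flip: exp_add)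
  then have "exp (r * x) / r\<^sup>2 * slope c (r * x) =
      (exp (r * x) * x * r - (exp (r * x) - 1)) / (r * r) - c * (exp (r * x) * x * x)"
    using assms(2) by (simp add: slope_def field_simps power2_eq_square)
  ultimately show ?thesis
    by (simp add: entropy_fun_exp[OF assms(1)] x_def)
qed

text \<open>The third hypothesis keeps the interval from \<open>p\<close> to \<open>q\<close> away
  from \<open>r = 0\<close>, where the quotient takes the default value of a division by zero
  instead of its limit \<open>ln t\<close>.\<close>

lemma entropy_fun_mono:
  assumes "0 < t" "p \<le> q" "0 < p \<or> q < 0"
    and "\<And>r. p \<le> r \<Longrightarrow> r \<le> q \<Longrightarrow> 0 \<le> slope c (r * ln t)"
  shows "entropy_fun c p t \<le> entropy_fun c q t"
proof (rule DERIV_nonneg_imp_nondecreasing[OF assms(2)])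
  fix r assume r: "p \<le> r" "r \<le> q"
  with assms(3) have "r \<noteq> 0" by auto
  from has_real_derivative_entropy_fun[OF assms(1) this] assms(4)[OF r]
  show "\<exists>y. ((\<lambda>r. entropy_fun c r t) has_real_derivative y) (at r) \<and> 0 \<le> y"
    by (blast intro: mult_nonneg_nonneg divide_nonneg_nonneg exp_ge_zero zero_le_power2)
qed

lemma entropy_fun_antimono:
  assumes "0 < t" "p \<le> q" "0 < p \<or> q < 0"
    and "\<And>r. p \<le> r \<Longrightarrow> r \<le> q \<Longrightarrow> slope c (r * ln t) \<le> 0"
  shows "entropy_fun c q t \<le> entropy_fun c p t"
proof (rule DERIV_nonpos_imp_nonincreasing[OF assms(2)])
  fix r assume r: "p \<le> r" "r \<le> q"
  with assms(3) have "r \<noteq> 0" by auto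
  from has_real_derivative_entropy_fun[OF assms(1) this] assms(4)[OF r]
  show "\<exists>y. ((\<lambda>r. entropy_fun c r t) has_real_derivative y) (at r) \<and> y \<le> 0"
    by (blast intro: mult_nonneg_nonpos divide_nonneg_nonneg exp_ge_zero zero_le_power2)
qed

text \<open>For \<open>p < 0 < q\<close> the derivative cannot be followed across
  \<open>r = 0\<close>. There the two quotients are separated by their common limit
  \<open>ln t\<close> at \<open>0\<close>, while \<open>exp (r * x) * x\<close> is nondecreasing in
  \<open>r\<close>.\<close>

lemma entropy_fun_le_nonpos_coeff:
  assumes "0 < t" "p \<le> q" "p \<noteq> 0" "q \<noteq> 0" "c \<le> 0"
  shows "entropy_fun c p t \<le> entropy_fun c q t"
proof (cases "0 < p \<or> q < 0")
  case True
  with assms show ?thesis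
    by (intro entropy_fun_mono slope_nonneg_nonpos_coeff)
next
  case False
  define x where "x = ln t"
  have exp_minus_one_ge: "y \<le> exp y - 1" for y :: real
    using exp_ge_add_one_self[of y] by linarith
  from False assms have p: "p < 0" and q: "0 < q" by auto
  have "(exp (p * x) - 1) / p \<le> x"
    unfolding neg_divide_le_eq[OF p] using exp_minus_one_ge[of "p * x"]
    by (simp only: mult.commute)
  also have "x \<le> (exp (q * x) - 1) / q"
    unfolding pos_le_divide_eq[OF q] using exp_minus_one_ge[of "q * x"]
    by (simp only: mult.commute)
  finally have "(exp (p * x) - 1) / p \<le> (exp (q * x) - 1) / q" .
  moreover have "exp (p * x) * x \<le> exp (q * x) * x"
  proof (cases "0 \<le> x")
    case True
    with assms(2) show ?thesis by (intro mult_right_mono) (auto intro: mult_right_mono)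
  next
    case False
    with assms(2) show ?thesis by (intro mult_right_mono_neg) (auto intro: mult_right_mono_neg)
  qed
  then have "c * (exp (q * x) * x) \<le> c * (exp (p * x) * x)"
    using assms(5) by (rule mult_left_mono_neg)
  ultimately show ?thesis
    by (simp add: entropy_fun_exp[OF assms(1)] x_def)
qed

section \<open>From bounds on \<open>u\<close> and \<open>v\<close> to bounds on
  \<open>r * ln t\<close>\<close>

text \<open>The threshold is nonnegative for \<open>c \<le> 1/2\<close>: the Taylor bound covers
  \<open>s \<le> 0\<close>, and the Pade bound covers the positive \<open>s\<close> up to the
  threshold.\<close>

lemma slope_nonneg_le:
  assumes "0 < c" "c \<le> 1/2" "s \<le> (1 - 2 * c) / c"
  shows "0 \<le> slope c s"
proof (cases "s \<le> 0")
  case False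
  with assms show ?thesis
    by (intro slope_nonneg_nonneg_arg) (auto simp: field_simps)
qed (use assms in \<open>simp add: slope_nonneg_nonpos_arg\<close>)

text \<open>Here the threshold is nonpositive, and the Pade bound covers the negative
  \<open>s\<close> above it.\<close>

lemma slope_nonpos_ge:
  assumes "1/2 \<le> c" "(1 - 2 * c) / c \<le> s"
  shows "slope c s \<le> 0"
proof (cases "0 \<le> s")
  case False
  with assms show ?thesis
    by (intro slope_nonpos_nonpos_arg) (auto simp: field_simps)
qed (use assms in \<open>simp add: slope_nonpos_nonneg_arg\<close>)

lemma mult_ln_le_iff_pos: "0 < t \<Longrightarrow> 0 < r \<Longrightarrow> r * ln t \<le> k \<longleftrightarrow> t \<le> exp (k / r)"
  for t r k :: real
  by (metis exp_le_cancel_iff exp_ln mult.commute pos_le_divide_eq)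

lemma mult_ln_ge_iff_pos: "0 < t \<Longrightarrow> 0 < r \<Longrightarrow> k \<le> r * ln t \<longleftrightarrow> exp (k / r) \<le> t"
  for t r k :: real
  by (metis exp_le_cancel_iff exp_ln mult.commute pos_divide_le_eq)

lemma mult_ln_le_iff_neg: "0 < t \<Longrightarrow> r < 0 \<Longrightarrow> r * ln t \<le> k \<longleftrightarrow> exp (k / r) \<le> t"
  for t r k :: real
  by (metis exp_le_cancel_iff exp_ln mult.commute neg_divide_le_eq)

lemma mult_ln_ge_iff_neg: "0 < t \<Longrightarrow> r < 0 \<Longrightarrow> k \<le> r * ln t \<longleftrightarrow> t \<le> exp (k / r)"
  for t r k :: real
  by (metis exp_le_cancel_iff exp_ln mult.commute neg_le_divide_eq)

text \<open>Each condition yields \<open>r * ln t \<le> (1 - 2 * c) / c\<close>. In the first two,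
  \<open>r\<close> and \<open>ln t\<close> have opposite signs; in the others the exponential bound
  controls the endpoint of the parameter interval at which \<open>r * ln t\<close> is
  largest.\<close>

lemma slope_nonneg_of_exp_bounds:
  assumes "0 < c" "c \<le> 1/2" "0 < u" "u \<le> t" "t \<le> v" "p \<le> r" "r \<le> q"
    and "(u \<ge> 1 \<and> -1 \<le> p \<and> p \<le> q \<and> q < 0) \<or>
         (v \<le> 1 \<and> 0 < p \<and> p \<le> q \<and> q \<le> 1) \<or>
         (1 \<le> u \<and> u \<le> v \<and> v \<le> exp ((1 - 2 * c) / (c * q)) \<and> 0 < p \<and> p \<le> q \<and> q \<le> 1) \<or>
         (exp ((1 - 2 * c) / (c * p)) \<le> u \<and> u \<le> v \<and> v \<le> 1 \<and> -1 \<le> p \<and> p \<le> q \<and> q < 0)"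
  shows "0 \<le> slope c (r * ln t)"
proof (rule slope_nonneg_le[OF assms(1,2)])
  have t: "0 < t" using assms(3,4) by simp
  have k: "0 \<le> (1 - 2 * c) / c" using assms(1,2) by simp
  from assms(8) consider "1 \<le> u" "q < 0" | "v \<le> 1" "0 < p"
    | "1 \<le> u" "v \<le> exp ((1 - 2 * c) / c / q)" "0 < p"
    | "exp ((1 - 2 * c) / c / p) \<le> u" "v \<le> 1" "q < 0"
    by (auto simp: mult.commute)
  then show "r * ln t \<le> (1 - 2 * c) / c"
  proof cases
    case 1
    with assms t have "r * ln t \<le> 0" by (intro mult_nonpos_nonneg) auto
    with k show ?thesis by simp
  next
    case 2
    with assms t have "r * ln t \<le> 0" by (intro mult_nonneg_nonpos) auto
    with k show ?thesis by simp
  next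
    case 3
    \<comment> \<open>Here \<open>ln t \<ge> 0\<close>, so the largest value is at
      \<open>r = q\<close>.\<close>
    with assms t have "r * ln t \<le> q * ln t" by (intro mult_right_mono) auto
    also have "\<dots> \<le> (1 - 2 * c) / c"
      using 3 assms t by (subst mult_ln_le_iff_pos) auto
    finally show ?thesis .
  next
    case 4
    \<comment> \<open>Here \<open>ln t \<le> 0\<close>, so the largest value is at
      \<open>r = p\<close>.\<close>
    with assms t have "r * ln t \<le> p * ln t" by (intro mult_right_mono_neg) auto
    also have "\<dots> \<le> (1 - 2 * c) / c"
      using 4 assms t by (subst mult_ln_le_iff_neg) auto
    finally show ?thesis .
  qed
qed

text \<open>The mirror image: the exponential bounds now control the endpoint at which
  \<open>r * ln t\<close> is smallest.\<close>

lemma slope_nonpos_of_exp_bounds: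
  assumes "1/2 \<le> c" "0 < u" "u \<le> t" "t \<le> v" "p \<le> r" "r \<le> q"
    and "(exp ((1 - 2 * c) / (c * q)) \<le> u \<and> u \<le> v \<and> v \<le> 1 \<and> 0 < p \<and> p \<le> q \<and> q \<le> 1) \<or>
         (1 \<le> u \<and> u \<le> v \<and> v \<le> exp ((1 - 2 * c) / (c * p)) \<and> -1 \<le> p \<and> p \<le> q \<and> q < 0) \<or>
         (u \<ge> 1 \<and> 0 < p \<and> p \<le> q \<and> q \<le> 1) \<or>
         (v \<le> 1 \<and> -1 \<le> p \<and> p \<le> q \<and> q < 0)"
  shows "slope c (r * ln t) \<le> 0"
proof (rule slope_nonpos_ge[OF assms(1)])
  have t: "0 < t" using assms(2,3) by simp
  have k: "(1 - 2 * c) / c \<le> 0" using assms(1) by (simp add: divide_le_0_iff)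
  from assms(7) consider "1 \<le> u" "0 < p" | "v \<le> 1" "q < 0"
    | "1 \<le> u" "v \<le> exp ((1 - 2 * c) / c / p)" "q < 0"
    | "exp ((1 - 2 * c) / c / q) \<le> u" "v \<le> 1" "0 < p"
    by (auto simp: mult.commute)
  then show "(1 - 2 * c) / c \<le> r * ln t"
  proof cases
    case 1
    with assms t have "0 \<le> r * ln t" by (intro mult_nonneg_nonneg) auto
    with k show ?thesis by simp
  next
    case 2
    with assms t have "0 \<le> r * ln t" by (intro mult_nonpos_nonpos) auto
    with k show ?thesis by simp
  next
    case 3
    then have "(1 - 2 * c) / c \<le> p * ln t"
      using assms t by (subst mult_ln_ge_iff_neg) auto
    also have "\<dots> \<le> r * ln t"
      using 3 assms t by (intro mult_right_mono) auto
    finally show ?thesis .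
  next
    case 4
    then have "(1 - 2 * c) / c \<le> q * ln t"
      using assms t by (subst mult_ln_ge_iff_pos) auto
    also have "\<dots> \<le> r * ln t"
      using 4 assms t by (intro mult_right_mono_neg) auto
    finally show ?thesis .
  qed
qed

section \<open>Self-adjoint operators\<close>

text \<open>Only the real inner product is required to be symmetric; with complex linearity,
  \<open>Im_cinner\<close> carries the symmetry over to the imaginary part, so this is
  self-adjointness in the complex sense.\<close>

definition selfadjoint_op :: "('a::chilbert_space \<Rightarrow>\<^sub>L 'a) \<Rightarrow> bool"
  where "selfadjoint_op T \<longleftrightarrow> clinear_op T \<and> (\<forall>x y. inner (T x) y = inner x (T y))"

lemma selfadjoint_opD:
  assumes "selfadjoint_op T"
  shows "clinear_op T" "inner (T x) y = inner x (T y)"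
  using assms by (auto simp: selfadjoint_op_def)

lemma Im_cinner: "Im (cinner x y) = inner x (\<i> *\<^sub>C y)"
  for x y :: "'a::complex_inner"
proof -
  have "cinner x (\<i> *\<^sub>C y) = cnj (\<i> * cinner y x)"
    by (subst cinner_commute) (simp add: cinner_scaleC_left)
  also have "\<dots> = - \<i> * cinner x y"
    by (subst (2) cinner_commute) simp
  finally show ?thesis
    by (simp add: inner_eq_Re_cinner)
qed

lemma inner_scaleC_i: "inner (\<i> *\<^sub>C x) (\<i> *\<^sub>C y) = inner x y"
  for x y :: "'a::complex_inner"
proof -
  have "inner (\<i> *\<^sub>C x) (\<i> *\<^sub>C y) = Im (cinner (\<i> *\<^sub>C x) y)"
    by (simp add: Im_cinner)
  then show ?thesis
    by (simp add: cinner_scaleC_left inner_eq_Re_cinner)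
qed

lemma scaleC_minus_one: "(- 1) *\<^sub>C x = - x"
  for x :: "'a::complex_vector"
  using scaleR_scaleC[of "- 1" x] by simp

lemma scaleC_scaleR: "z *\<^sub>C (r *\<^sub>R x) = r *\<^sub>R (z *\<^sub>C x)"
  for x :: "'a::complex_vector"
  by (simp add: scaleR_scaleC scaleC_scaleC mult.commute)

lemma scaleC_zero_right: "z *\<^sub>C 0 = (0::'a::complex_vector)"
  using scaleC_scaleR[of z 0 0] by simp

lemma clinear_op_zero [simp]: "clinear_op 0"
  by (simp add: clinear_op_def scaleC_zero_right)

lemma clinear_op_add: "clinear_op S \<Longrightarrow> clinear_op T \<Longrightarrow> clinear_op (S + T)"
  by (simp add: clinear_op_def blinfun.add_left scaleC_add_right)

lemma clinear_op_scaleR: "clinear_op T \<Longrightarrow> clinear_op (r *\<^sub>R T)"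
  by (simp add: clinear_op_def blinfun.scaleR_left scaleC_scaleR)

lemma clinear_op_id [simp]: "clinear_op id_blinfun"
  by (simp add: clinear_op_def)

lemma clinear_op_compose: "clinear_op S \<Longrightarrow> clinear_op T \<Longrightarrow> clinear_op (S o\<^sub>L T)"
  by (simp add: clinear_op_def)

lemma selfadjoint_op_add: "selfadjoint_op S \<Longrightarrow> selfadjoint_op T \<Longrightarrow> selfadjoint_op (S + T)"
  by (simp add: selfadjoint_op_def clinear_op_add blinfun.add_left inner_add_left inner_add_right)

lemma selfadjoint_op_scaleR: "selfadjoint_op T \<Longrightarrow> selfadjoint_op (r *\<^sub>R T)"
  by (simp add: selfadjoint_op_def clinear_op_scaleR blinfun.scaleR_left)

lemma selfadjoint_op_diff:
  assumes "selfadjoint_op S" "selfadjoint_op T"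
  shows "selfadjoint_op (S - T)"
  using selfadjoint_op_add[OF assms(1) selfadjoint_op_scaleR[OF assms(2), of "- 1"]] by simp

lemma selfadjoint_op_zero [simp]: "selfadjoint_op 0"
  by (simp add: selfadjoint_op_def)

lemma selfadjoint_op_id [simp]: "selfadjoint_op id_blinfun"
  by (simp add: selfadjoint_op_def)

lemma selfadjoint_op_congruence:
  assumes "selfadjoint_op R" "selfadjoint_op S"
  shows "selfadjoint_op (R o\<^sub>L S o\<^sub>L R)"
  using assms by (simp add: selfadjoint_op_def clinear_op_compose)

text \<open>Polarisation: over the complex numbers a real-valued quadratic form comes from a
  symmetric operator. Conversely, symmetry makes the imaginary part of the form equal to its own
  negative.\<close>

lemma positive_op_iff:
  "positive_op T \<longleftrightarrow> selfadjoint_op T \<and> (\<forall>x. 0 \<le> inner (T x) x)"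
proof
  assume T: "positive_op T"
  then have c: "T (z *\<^sub>C x) = z *\<^sub>C T x" for z x
    by (simp add: positive_op_def clinear_op_def)
  have pos: "0 \<le> inner (T x) x" for x
    using T by (simp add: positive_op_def inner_eq_Re_cinner complex_nonneg_Reals_iff)
  have im: "inner (T x) (\<i> *\<^sub>C x) = 0" for x
    using T by (simp add: positive_op_def complex_nonneg_Reals_iff flip: Im_cinner)
  have "inner (T x) y = inner x (T y)" for x y
  proof -
    \<comment> \<open>This choice turns the vanishing imaginary part at \<open>x + w\<close> into a
      relation between real inner products of \<open>x\<close> and \<open>y\<close>.\<close>
    define w where "w = (- \<i>) *\<^sub>C y"
    have y: "\<i> *\<^sub>C w = y"
      by (simp add: w_def scaleC_scaleC) (use scaleR_scaleC[of 1 y] in simp)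
    have "inner (T x) (\<i> *\<^sub>C w) + inner (T w) (\<i> *\<^sub>C x) = 0"
      using im[of "x + w"] im[of x] im[of w]
      by (simp add: blinfun.add_right scaleC_add_right inner_add_left inner_add_right)
    \<comment> \<open>Multiplication by \<open>\<i>\<close> preserves \<open>inner\<close>, commutes
      with \<open>T\<close> and squares to \<open>- 1\<close>, so \<open>\<i>\<close> can be moved
      from \<open>x\<close> to \<open>w\<close>.\<close>
    moreover have "inner (T w) (\<i> *\<^sub>C x) = inner (\<i> *\<^sub>C T w) (\<i> *\<^sub>C (\<i> *\<^sub>C x))"
      by (simp only: inner_scaleC_i)
    then have "inner (T w) (\<i> *\<^sub>C x) = - inner (T y) x"
      by (simp add: scaleC_scaleC scaleC_minus_one y flip: c)
    ultimately show ?thesis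
      by (simp add: y inner_commute)
  qed
  with T pos show "selfadjoint_op T \<and> (\<forall>x. 0 \<le> inner (T x) x)"
    by (auto simp: selfadjoint_op_def positive_op_def)
next
  assume T: "selfadjoint_op T \<and> (\<forall>x. 0 \<le> inner (T x) x)"
  have "inner (T x) (\<i> *\<^sub>C x) = 0" for x
  proof -
    have "inner (T x) (\<i> *\<^sub>C x) = inner x (\<i> *\<^sub>C T x)"
      using T by (simp add: selfadjoint_op_def clinear_op_def)
    also have "\<dots> = inner (\<i> *\<^sub>C x) (\<i> *\<^sub>C (\<i> *\<^sub>C T x))"
      by (simp only: inner_scaleC_i)
    also have "\<dots> = - inner (T x) (\<i> *\<^sub>C x)"
      by (simp add: scaleC_scaleC scaleC_minus_one inner_commute)
    finally show ?thesis by simp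
  qed
  then have "cinner (T x) x \<in> \<real>\<^sub>\<ge>\<^sub>0" for x
    using T by (simp only: complex_nonneg_Reals_iff Im_cinner flip: inner_eq_Re_cinner)
  with T show "positive_op T"
    by (simp add: positive_op_def selfadjoint_op_def)
qed

lemma positive_op_congruence:
  assumes "selfadjoint_op R" "positive_op S"
  shows "positive_op (R o\<^sub>L S o\<^sub>L R)"
proof -
  have "inner ((R o\<^sub>L S o\<^sub>L R) x) x = inner (S (R x)) (R x)" for x
    using selfadjoint_opD(2)[OF assms(1), of "S (R x)" x] by simp
  with assms show ?thesis
    by (simp add: positive_op_iff selfadjoint_op_congruence)
qed

section \<open>Invertibility\<close>

lemma invertible_op_compose:
  assumes "invertible_op S" "invertible_op T"
  shows "invertible_op (S o\<^sub>L T)"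
proof -
  from assms obtain S' T' where *: "clinear_op S'" "clinear_op T'"
    "S' o\<^sub>L S = id_blinfun" "S o\<^sub>L S' = id_blinfun" "T' o\<^sub>L T = id_blinfun" "T o\<^sub>L T' = id_blinfun"
    unfolding invertible_op_def by blast
  then have "S' (S x) = x" "S (S' x) = x" "T' (T x) = x" "T (T' x) = x" for x
    by (metis blinfun_apply_blinfun_compose blinfun_apply_id_blinfun)+
  then have "(T' o\<^sub>L S') o\<^sub>L (S o\<^sub>L T) = id_blinfun" "(S o\<^sub>L T) o\<^sub>L (T' o\<^sub>L S') = id_blinfun"
    by (auto intro!: blinfun_eqI)
  with * show ?thesis
    unfolding invertible_op_def by (blast intro: clinear_op_compose)
qed

lemma invertible_op_bounded_below:
  assumes "invertible_op T"
  obtains C where "0 < C" "\<And>x. norm x \<le> C * norm (T x)"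
proof -
  from assms obtain S where "S o\<^sub>L T = id_blinfun"
    unfolding invertible_op_def by blast
  then have "S (T x) = x" for x
    by (metis blinfun_apply_blinfun_compose blinfun_apply_id_blinfun)
  then have "norm x \<le> norm S * norm (T x)" for x
    using norm_blinfun[of S "T x"] by simp
  \<comment> \<open>The constant \<open>norm S + 1\<close> is positive even on the trivial space,
    where \<open>norm S = 0\<close>.\<close>
  moreover have "norm S * norm (T x) \<le> (norm S + 1) * norm (T x)" for x
    by (simp add: mult_right_mono)
  ultimately show thesis
    by (intro that[of "norm S + 1"]) (auto intro: order_trans add_nonneg_pos)
qed

text \<open>The Lax--Milgram argument: for small \<open>e\<close>, solutions of \<open>T x = y\<close> are the fixed points of
  the contraction \<open>x \<mapsto> x - e (T x - y)\<close>.\<close>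

lemma coercive_surj:
  fixes T :: "'a::chilbert_space \<Rightarrow>\<^sub>L 'a"
  assumes "0 < \<alpha>" and co: "\<And>x. \<alpha> * (norm x)\<^sup>2 \<le> inner (T x) x"
  shows "\<exists>x. T x = y"
proof -
  \<comment> \<open>The squared contraction factor is at most
    \<open>1 - 2 * e * \<alpha> + e\<^sup>2 * D\<close>; \<open>e = \<alpha> / D\<close> minimises
    this, with minimum \<open>k\<^sup>2\<close>. The summand \<open>\<alpha>\<^sup>2\<close> keeps
    \<open>D\<close> positive and \<open>1 - \<alpha>\<^sup>2 / D\<close> nonnegative.\<close>
  define D where "D = (norm T)\<^sup>2 + \<alpha>\<^sup>2"
  define e where "e = \<alpha> / D"
  define k where "k = sqrt (1 - \<alpha>\<^sup>2 / D)"
  have D: "0 < D" "\<alpha>\<^sup>2 \<le> D" "(norm T)\<^sup>2 \<le> D" and "0 < e"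
    using assms(1) by (simp_all add: D_def e_def add_nonneg_pos)
  have k: "0 \<le> k" "k < 1" "k\<^sup>2 = 1 - \<alpha>\<^sup>2 / D"
    using D assms(1) by (simp_all add: k_def)
  have contr: "norm (x - e *\<^sub>R T x) \<le> k * norm x" for x
  proof (rule power2_le_imp_le)
    have "(norm (x - e *\<^sub>R T x))\<^sup>2 = (norm x)\<^sup>2 - 2 * e * inner (T x) x + e\<^sup>2 * (norm (T x))\<^sup>2"
      by (simp add: power2_norm_eq_inner inner_diff_left inner_diff_right inner_commute
          power2_eq_square[of e] algebra_simps)
    also have "\<dots> \<le> (norm x)\<^sup>2 - 2 * e * (\<alpha> * (norm x)\<^sup>2) + e\<^sup>2 * (D * (norm x)\<^sup>2)"
    proof -
      have "(norm (T x))\<^sup>2 \<le> (norm T)\<^sup>2 * (norm x)\<^sup>2"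
        using power_mono[OF norm_blinfun[of T x], of 2] by (simp add: power_mult_distrib)
      also have "\<dots> \<le> D * (norm x)\<^sup>2"
        using D(3) by (intro mult_right_mono) auto
      finally have "e\<^sup>2 * (norm (T x))\<^sup>2 \<le> e\<^sup>2 * (D * (norm x)\<^sup>2)"
        by (intro mult_left_mono) auto
      moreover have "2 * e * (\<alpha> * (norm x)\<^sup>2) \<le> 2 * e * inner (T x) x"
        using co[of x] \<open>0 < e\<close> by (intro mult_left_mono) auto
      ultimately show ?thesis by linarith
    qed
    also have "\<dots> = (k * norm x)\<^sup>2"
      unfolding power_mult_distrib k(3) e_def using D(1)
      by (simp add: field_simps power2_eq_square)
    finally show "(norm (x - e *\<^sub>R T x))\<^sup>2 \<le> (k * norm x)\<^sup>2" .
  qed (use k in simp)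
  define g where "g = (\<lambda>x. x - e *\<^sub>R (T x - y))"
  have "dist (g x) (g z) \<le> k * dist x z" for x z
    using contr[of "x - z"] by (simp add: dist_norm g_def blinfun.diff_right algebra_simps)
  then obtain x where "g x = x"
    using banach_fix_type[OF k(1,2), of g] by blast
  with \<open>0 < e\<close> show ?thesis
    by (auto simp: g_def)
qed

text \<open>Coercivity bounds \<open>T\<close> below, which gives injectivity and the norm bound
  \<open>1 / \<alpha>\<close> for the inverse. Preimages come from \<open>coercive_surj\<close>, and
  injectivity makes choosing them a complex-linear operation.\<close>

lemma coercive_invertible:
  fixes T :: "'a::chilbert_space \<Rightarrow>\<^sub>L 'a"
  assumes "0 < \<alpha>" and co: "\<And>x. \<alpha> * (norm x)\<^sup>2 \<le> inner (T x) x" and "clinear_op T"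
  shows "invertible_op T"
proof -
  have below: "norm x \<le> norm (T x) / \<alpha>" for x
  proof (cases "x = 0")
    case False
    have "\<alpha> * norm x * norm x \<le> norm (T x) * norm x"
      using co[of x] norm_cauchy_schwarz[of "T x" x] by (simp add: power2_eq_square mult.assoc)
    with False have "\<alpha> * norm x \<le> norm (T x)"
      by simp
    with assms(1) show ?thesis
      by (simp add: field_simps)
  qed simp
  have inj: "x = z" if "T x = T z" for x z
    using below[of "x - z"] that by (simp add: blinfun.diff_right)
  obtain S where S: "T (S y) = y" for y
    using coercive_surj[OF assms(1) co] by metis
  have "bounded_linear S"
  proof (rule bounded_linear_intro[where K = "1 / \<alpha>"])
    show "S (x + y) = S x + S y" "S (r *\<^sub>R x) = r *\<^sub>R S x" for x y r
      by (rule inj, simp add: S blinfun.add_right blinfun.scaleR_right)+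
    show "norm (S x) \<le> norm x * (1 / \<alpha>)" for x
      using below[of "S x"] by (simp add: S)
  qed
  then have ap: "blinfun_apply (Blinfun S) = S"
    by (rule bounded_linear_Blinfun_apply)
  have "S (z *\<^sub>C x) = z *\<^sub>C S x" for z x
    using assms(3) by (intro inj[of "S (z *\<^sub>C x)"]) (simp add: clinear_op_def S)
  then have "clinear_op (Blinfun S)"
    by (simp add: clinear_op_def ap)
  moreover have "Blinfun S o\<^sub>L T = id_blinfun" "T o\<^sub>L Blinfun S = id_blinfun"
    by (auto intro!: blinfun_eqI inj[of "S _"] simp: ap S)
  ultimately show ?thesis
    unfolding invertible_op_def by blast
qed

text \<open>Evaluating the form at \<open>x - s T x\<close> with \<open>s = 1 / N\<close>.\<close>

lemma positive_norm_le:
  assumes "positive_op T" "norm T \<le> N" "0 < N"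
  shows "(norm (T x))\<^sup>2 \<le> N * inner (T x) x"
proof -
  define s where "s = 1 / N"
  define w where "w = x - s *\<^sub>R T x"
  have sa: "inner (T y) z = inner y (T z)" for y z
    using assms(1) by (simp add: positive_op_iff selfadjoint_op_def)
  have "inner (T (T x)) (T x) \<le> N * (norm (T x))\<^sup>2"
  proof -
    have "inner (T (T x)) (T x) \<le> norm (T (T x)) * norm (T x)"
      by (rule norm_cauchy_schwarz)
    also have "\<dots> \<le> N * norm (T x) * norm (T x)"
      by (intro mult_right_mono order_trans[OF norm_blinfun mult_right_mono[OF assms(2)]]) simp_all
    finally show ?thesis by (simp add: power2_eq_square)
  qed
  then have "s\<^sup>2 * inner (T (T x)) (T x) \<le> s\<^sup>2 * (N * (norm (T x))\<^sup>2)"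
    by (rule mult_left_mono) simp
  also have "\<dots> = s * (norm (T x))\<^sup>2"
    using assms(3) by (simp add: s_def power2_eq_square)
  finally have le: "s\<^sup>2 * inner (T (T x)) (T x) \<le> s * (norm (T x))\<^sup>2" .
  have "0 \<le> inner (T w) w"
    using assms(1) by (simp add: positive_op_iff)
  also have "\<dots> = inner (T x) x - 2 * (s * (norm (T x))\<^sup>2) + s\<^sup>2 * inner (T (T x)) (T x)"
    by (simp add: w_def blinfun.diff_right blinfun.scaleR_right inner_diff_left inner_diff_right
        power2_norm_eq_inner sa[of "T x" x] power2_eq_square[of s] algebra_simps)
  finally have "s * (norm (T x))\<^sup>2 \<le> inner (T x) x"
    using le by simp
  then show ?thesis
    using assms(3) by (simp add: s_def field_simps)
qed

text \<open>Invertibility gives \<open>norm x \<le> C * norm (T x)\<close>, and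
  \<open>positive_norm_le\<close> passes from \<open>norm (T x)\<close> to the quadratic form,
  whence the constant \<open>1 / (C\<^sup>2 * N)\<close>.\<close>

lemma strictly_positive_coercive:
  assumes "strictly_positive_op T"
  obtains \<delta> where "0 < \<delta>" "\<And>x. \<delta> * (norm x)\<^sup>2 \<le> inner (T x) x"
proof -
  from assms have T: "positive_op T" and "invertible_op T"
    by (auto simp: strictly_positive_op_def)
  then obtain C where C: "0 < C" "norm x \<le> C * norm (T x)" for x
    using invertible_op_bounded_below by blast
  define N where "N = norm T + 1"
  have N: "0 < N" "norm T \<le> N"
    by (auto simp: N_def add_nonneg_pos)
  have "1 / (C\<^sup>2 * N) * (norm x)\<^sup>2 \<le> inner (T x) x" for x
  proof -
    have "(norm x)\<^sup>2 \<le> C\<^sup>2 * (norm (T x))\<^sup>2"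
      using power_mono[OF C(2)[of x], of 2] by (simp add: power_mult_distrib)
    also have "\<dots> \<le> C\<^sup>2 * (N * inner (T x) x)"
      by (intro mult_left_mono positive_norm_le[OF T N(2,1)]) simp
    finally show ?thesis
      using C(1) N(1) by (simp add: field_simps)
  qed
  with C(1) N(1) show thesis
    by (intro that[of "1 / (C\<^sup>2 * N)"]) auto
qed

lemma abs_inner_op_le: "\<bar>inner (T x) x\<bar> \<le> norm T * (norm x)\<^sup>2"
  for T :: "'a::real_inner \<Rightarrow>\<^sub>L 'a"
proof -
  have "\<bar>inner (T x) x\<bar> \<le> norm (T x) * norm x"
    by (rule Cauchy_Schwarz_ineq2)
  also have "\<dots> \<le> norm T * norm x * norm x"
    by (intro mult_right_mono norm_blinfun) simp
  finally show ?thesis by (simp add: power2_eq_square)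
qed

section \<open>Polynomials of an operator\<close>

lemma poly_op_0 [simp]: "poly_op 0 T = 0"
  by (simp add: poly_op_def)

text \<open>A Horner recursion, which lets the algebraic laws of \<open>poly_op\<close> be proved by
  induction over \<open>pCons\<close>.\<close>

lemma poly_op_pCons: "poly_op (pCons a P) T = a *\<^sub>R id_blinfun + (T o\<^sub>L poly_op P T)"
proof (cases "P = 0")
  case False
  \<comment> \<open>Only for \<open>P \<noteq> 0\<close> does \<open>pCons\<close> raise the degree
    by one.\<close>
  have "poly_op (pCons a P) T =
      (\<Sum>i\<le>Suc (degree P). coeff (pCons a P) i *\<^sub>R (((o\<^sub>L) T ^^ i) id_blinfun))"
    using False by (simp add: poly_op_def)
  also have "\<dots> = a *\<^sub>R id_blinfun + (\<Sum>i\<le>degree P. coeff P i *\<^sub>R (T o\<^sub>L ((o\<^sub>L) T ^^ i) id_blinfun))"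
    by (subst sum.atMost_Suc_shift) simp
  also have "(\<Sum>i\<le>degree P. coeff P i *\<^sub>R (T o\<^sub>L ((o\<^sub>L) T ^^ i) id_blinfun)) = T o\<^sub>L poly_op P T"
    by (simp add: poly_op_def bounded_bilinear.sum_right[OF bounded_bilinear_blinfun_compose]
        bounded_bilinear.scaleR_right[OF bounded_bilinear_blinfun_compose])
  finally show ?thesis .
qed (simp add: poly_op_def)

lemma poly_op_pCons_apply: "poly_op (pCons a P) T x = a *\<^sub>R x + T (poly_op P T x)"
  by (simp add: poly_op_pCons blinfun.add_left blinfun.scaleR_left)

lemma poly_op_const: "poly_op [:a:] T = a *\<^sub>R id_blinfun"
  by (simp add: poly_op_pCons)

lemma poly_op_ident: "poly_op [:0, 1:] T = T"
  by (auto intro!: blinfun_eqI simp: poly_op_pCons_apply)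

lemma poly_op_add: "poly_op (P + Q) T = poly_op P T + poly_op Q T"
proof (induction P Q rule: poly_induct2)
  case (pCons a P b Q)
  then show ?case
    by (intro blinfun_eqI)
      (simp add: poly_op_pCons_apply blinfun.add_left blinfun.add_right scaleR_add_left)
qed simp

lemma poly_op_smult: "poly_op (smult a P) T = a *\<^sub>R poly_op P T"
proof (induction P)
  case (pCons b P)
  then show ?case
    by (intro blinfun_eqI)
      (simp add: poly_op_pCons_apply blinfun.scaleR_left blinfun.scaleR_right scaleR_add_right)
qed simp

lemma poly_op_diff: "poly_op (P - Q) T = poly_op P T - poly_op Q T"
  using poly_op_add[of P "- Q" T] poly_op_smult[of "- 1" Q T] by simp

lemma poly_op_mult: "poly_op (P * Q) T = poly_op P T o\<^sub>L poly_op Q T"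
proof (induction P)
  case (pCons a P)
  have "poly_op (pCons a P * Q) T = poly_op (smult a Q) T + poly_op (pCons 0 (P * Q)) T"
    by (simp flip: poly_op_add)
  with pCons show ?case
    by (intro blinfun_eqI)
      (simp add: poly_op_smult poly_op_pCons_apply blinfun.add_left blinfun.scaleR_left)
qed simp

lemma poly_op_commute: "poly_op P T (poly_op Q T x) = poly_op Q T (poly_op P T x)"
  using arg_cong[OF mult.commute[of P Q], of "\<lambda>R. poly_op R T x"] by (simp add: poly_op_mult)

lemma poly_op_arg_commute: "poly_op P T (T x) = T (poly_op P T x)"
  using poly_op_commute[of P T "[:0, 1:]" x] by (simp add: poly_op_ident)

lemma selfadjoint_poly_op:
  assumes "selfadjoint_op T"
  shows "selfadjoint_op (poly_op P T)"
proof (induction P)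
  case (pCons a P)
  have "selfadjoint_op (T o\<^sub>L poly_op P T)"
    using assms pCons(2) by (simp add: selfadjoint_op_def clinear_op_compose poly_op_arg_commute)
  then show ?case
    by (simp add: poly_op_pCons selfadjoint_op_add selfadjoint_op_scaleR)
qed simp

section \<open>Real spectrum and invertibility of polynomials\<close>

definition real_spectrum :: "('a::chilbert_space \<Rightarrow>\<^sub>L 'a) \<Rightarrow> real set"
  where "real_spectrum T = {t. complex_of_real t \<in> spectrum_op T}"

lemma scalar_op_of_real: "scalar_op (complex_of_real t) = t *\<^sub>R id_blinfun"
  by (auto intro!: blinfun_eqI simp: blinfun.scaleR_left scaleR_scaleC)

lemma real_spectrum_iff: "t \<in> real_spectrum T \<longleftrightarrow> \<not> invertible_op (T - t *\<^sub>R id_blinfun)"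
  by (simp add: real_spectrum_def spectrum_op_def scalar_op_of_real)

text \<open>For \<open>t < m\<close> the operator \<open>T - t\<close> is coercive with constant
  \<open>m - t\<close>; for \<open>t > M\<close> its negative is coercive with constant
  \<open>t - M\<close>.\<close>

lemma real_spectrum_subset:
  assumes "selfadjoint_op T" "\<And>x. m * (norm x)\<^sup>2 \<le> inner (T x) x"
    "\<And>x. inner (T x) x \<le> M * (norm x)\<^sup>2"
  shows "real_spectrum T \<subseteq> {m..M}"
proof
  fix t assume t: "t \<in> real_spectrum T"
  have "selfadjoint_op (T - t *\<^sub>R id_blinfun)"
    using assms(1) by (intro selfadjoint_op_diff selfadjoint_op_scaleR selfadjoint_op_id)
  then have c: "clinear_op (T - t *\<^sub>R id_blinfun)" "clinear_op (- 1 *\<^sub>R (T - t *\<^sub>R id_blinfun))"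
    by (simp_all only: selfadjoint_opD(1) clinear_op_scaleR)
  have "m \<le> t"
  proof (rule ccontr)
    assume "\<not> m \<le> t"
    then have "invertible_op (T - t *\<^sub>R id_blinfun)"
      using assms(2)
      by (intro coercive_invertible[where \<alpha> = "m - t"] c(1))
        (auto simp: blinfun.diff_left blinfun.scaleR_left inner_diff_left left_diff_distrib
          power2_norm_eq_inner)
    with t show False by (simp add: real_spectrum_iff)
  qed
  moreover have "t \<le> M"
  proof (rule ccontr)
    assume "\<not> t \<le> M"
    then have "invertible_op (- 1 *\<^sub>R (T - t *\<^sub>R id_blinfun))"
      using assms(3)
      by (intro coercive_invertible[where \<alpha> = "t - M"] c(2))
        (auto simp: blinfun.diff_left blinfun.minus_left blinfun.scaleR_left inner_diff_left
          left_diff_distrib power2_norm_eq_inner)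
    \<comment> \<open>Composition with \<open>- id_blinfun\<close> undoes the change of
      sign.\<close>
    moreover have "invertible_op (- 1 *\<^sub>R id_blinfun :: 'a \<Rightarrow>\<^sub>L 'a)"
      unfolding invertible_op_def
      by (rule exI[of _ "- 1 *\<^sub>R id_blinfun"])
        (simp only: clinear_op_scaleR clinear_op_id, auto intro!: blinfun_eqI simp: blinfun.minus_left blinfun.minus_right)
    ultimately have "invertible_op ((- 1 *\<^sub>R id_blinfun) o\<^sub>L (- 1 *\<^sub>R (T - t *\<^sub>R id_blinfun)))"
      by (intro invertible_op_compose)
    also have "(- 1 *\<^sub>R id_blinfun) o\<^sub>L (- 1 *\<^sub>R (T - t *\<^sub>R id_blinfun)) = T - t *\<^sub>R id_blinfun"
      by (auto intro!: blinfun_eqI simp: blinfun.minus_left blinfun.diff_left)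
    finally show False
      using t by (simp add: real_spectrum_iff)
  qed
  ultimately show "t \<in> {m..M}" by simp
qed

lemma poly_map_poly_of_real_add:
  "poly (map_poly complex_of_real (P + Q)) z =
    poly (map_poly complex_of_real P) z + poly (map_poly complex_of_real Q) z"
proof (induction P Q rule: poly_induct2)
  case (pCons a P b Q)
  then show ?case by (simp add: map_poly_pCons algebra_simps)
qed simp

lemma poly_map_poly_of_real_mult:
  "poly (map_poly complex_of_real (P * Q)) z =
    poly (map_poly complex_of_real P) z * poly (map_poly complex_of_real Q) z"
proof (induction P)
  case (pCons a P)
  have "poly (map_poly complex_of_real (smult a Q)) z = a * poly (map_poly complex_of_real Q) z"
    by (induction Q) (simp_all add: map_poly_pCons algebra_simps)
  with pCons show ?case
    by (simp add: poly_map_poly_of_real_add map_poly_pCons algebra_simps)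
qed simp

text \<open>A complex root \<open>a + i b\<close> of \<open>Q\<close> is nonreal, as
  \<open>Q\<close> has no real root. The divisor is \<open>(t - a)\<^sup>2 + b\<^sup>2\<close>,
  whose roots are this number and its conjugate.\<close>

lemma real_poly_quadratic_factor:
  fixes Q :: "real poly"
  assumes "0 < degree Q" "\<And>t. poly Q t \<noteq> 0"
  obtains a b where "b \<noteq> 0" "[:a\<^sup>2 + b\<^sup>2, - 2 * a, 1:] dvd Q"
proof -
  let ?C = "map_poly complex_of_real"
  have [simp]: "degree (?C Q) = degree Q"
    by (rule degree_map_poly) simp
  then have "\<not> constant (poly (?C Q))"
    using assms(1) by (simp add: constant_degree)
  then obtain z where z: "poly (?C Q) z = 0"
    using fundamental_theorem_of_algebra by blast
  define a b where "a = Re z" and "b = Im z"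
  have zab: "z = Complex a b" by (simp add: a_def b_def)
  have b: "b \<noteq> 0"
  proof
    assume "b = 0"
    then have "z = complex_of_real a" by (simp add: zab complex_eq_iff)
    moreover have "poly (?C Q) (complex_of_real a) = complex_of_real (poly Q a)"
      by (induction Q) (simp_all add: map_poly_pCons)
    ultimately show False
      using z assms(2)[of a] by simp
  qed
  define D where "D = [:a\<^sup>2 + b\<^sup>2, - 2 * a, 1:]"
  have "degree (Q mod D) < 2"
    using degree_mod_less'[of D Q] by (cases "Q mod D = 0") (auto simp: D_def)
  moreover obtain r P where P: "Q mod D = pCons r P"
    by (cases "Q mod D")
  ultimately have "degree P = 0"
    by (cases "P = 0") auto
  then obtain s where R: "Q mod D = [:r, s:]"
    using P by (auto elim: degree_eq_zeroE)
  have "poly (?C D) z = 0"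
  proof -
    have "poly (?C D) z = (z - a) * (z - a) + b * b"
      by (simp add: D_def map_poly_pCons power2_eq_square algebra_simps)
    also have "z - a = \<i> * b"
      by (simp add: zab complex_eq_iff)
    finally show ?thesis
      by (simp add: algebra_simps)
  qed
  moreover have "poly (?C Q) z = poly (?C (Q div D)) z * poly (?C D) z + poly (?C (Q mod D)) z"
    by (simp flip: poly_map_poly_of_real_mult poly_map_poly_of_real_add)
  ultimately have "poly (?C (Q mod D)) z = 0"
    using z by simp
  \<comment> \<open>A real polynomial of degree at most one that vanishes at a nonreal point is
    zero: the imaginary part is \<open>s * b\<close>.\<close>
  then have "s = 0" "r = 0"
    using b by (auto simp: R zab map_poly_pCons complex_eq_iff)
  then have "D dvd Q"
    using R by (simp add: mod_eq_0_iff_dvd)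
  with b show thesis
    unfolding D_def by (rule that)
qed

text \<open>One inclusion of the spectral mapping theorem, by splitting off invertible factors: a
  nonzero constant, \<open>T - t\<close> for a real root \<open>t\<close>, which is not spectral by
  hypothesis, or a quadratic without real roots.\<close>

lemma invertible_poly_op:
  assumes "selfadjoint_op T" "Q \<noteq> 0" "\<And>t. t \<in> real_spectrum T \<Longrightarrow> poly Q t \<noteq> 0"
  shows "invertible_op (poly_op Q T)"
  using assms(2,3)
proof (induction "degree Q" arbitrary: Q rule: less_induct)
  case less
  have step: "invertible_op (poly_op Q T)"
    if "D dvd Q" "0 < degree D" "invertible_op (poly_op D T)" for D
  proof -
    from that(1) obtain R where R: "Q = D * R" by blast
    with less.prems have "R \<noteq> 0" by auto
    moreover from this R less.prems(1) have "degree R < degree Q"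
      using that(2) by (auto simp: degree_mult_eq)
    moreover have "poly R t \<noteq> 0" if "t \<in> real_spectrum T" for t
      using less.prems(2)[OF that] R by auto
    ultimately have "invertible_op (poly_op R T)"
      by (intro less.hyps)
    with that(3) show ?thesis
      by (simp add: R poly_op_mult invertible_op_compose)
  qed
  consider "degree Q = 0" | t where "poly Q t = 0" | "0 < degree Q" "\<And>t. poly Q t \<noteq> 0"
    by blast
  then show ?case
  proof cases
    case 1
    then obtain a where a: "Q = [:a:]" by (rule degree_eq_zeroE)
    with less.prems(1) have "a \<noteq> 0" by simp
    then show ?thesis
      unfolding invertible_op_def a poly_op_const
      by (intro exI[of _ "(1 / a) *\<^sub>R id_blinfun"])
        (auto intro!: blinfun_eqI clinear_op_scaleR
          simp: blinfun.scaleR_left)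
  next
    case (2 t)
    then have "invertible_op (T - t *\<^sub>R id_blinfun)"
      using less.prems(2)[of t] by (auto simp: real_spectrum_iff)
    moreover have "poly_op [:- t, 1:] T = T - t *\<^sub>R id_blinfun"
      by (auto intro!: blinfun_eqI
          simp: poly_op_pCons_apply blinfun.diff_left blinfun.scaleR_left)
    ultimately show ?thesis
      using 2 by (intro step[of "[:- t, 1:]"]) (auto simp: poly_eq_0_iff_dvd)
  next
    case 3
    then obtain a b where ab: "b \<noteq> 0" "[:a\<^sup>2 + b\<^sup>2, - 2 * a, 1:] dvd Q"
      using real_poly_quadratic_factor by blast
    let ?D = "[:a\<^sup>2 + b\<^sup>2, - 2 * a, 1:]"
    have "invertible_op (poly_op ?D T)"
    proof (rule coercive_invertible[where \<alpha> = "b\<^sup>2"])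
      show "clinear_op (poly_op ?D T)"
        using selfadjoint_poly_op[OF assms(1)] by (rule selfadjoint_opD)
      show "b\<^sup>2 * (norm x)\<^sup>2 \<le> inner (poly_op ?D T x) x" for x
      proof -
        \<comment> \<open>Completing the square in \<open>?D\<close> exhibits
          \<open>b\<^sup>2\<close> as the coercivity constant.\<close>
        have "inner (poly_op ?D T x) x = b\<^sup>2 * (norm x)\<^sup>2 + inner (T x - a *\<^sub>R x) (T x - a *\<^sub>R x)"
          using selfadjoint_opD(2)[OF assms(1), of "T x" x]
          by (simp add: poly_op_pCons_apply power2_norm_eq_inner inner_diff_left inner_diff_right
              inner_add_left algebra_simps power2_eq_square[of a] blinfun.scaleR_right blinfun.diff_right
              blinfun.add_right inner_commute)
        then show ?thesis by simp
      qed
    qed (use ab in simp)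
    with ab(2) show ?thesis
      by (intro step[of ?D]) auto
  qed
qed

section \<open>Positivity and norm bounds for polynomials\<close>

text \<open>\<open>K\<close> collects the nonnegative shifts that make \<open>S\<close> positive. If
  its infimum \<open>a\<close> were positive, \<open>P + a\<close> would have no zero on the
  spectrum, so \<open>S + a\<close> would be invertible, hence coercive, and a smaller shift would
  do.\<close>

lemma poly_op_nonneg_nonconst:
  assumes "selfadjoint_op T" "0 < degree P" "\<And>t. t \<in> real_spectrum T \<Longrightarrow> 0 \<le> poly P t"
  shows "0 \<le> inner (poly_op P T x) x"
proof -
  define S where "S = poly_op P T"
  have S: "selfadjoint_op S"
    unfolding S_def by (rule selfadjoint_poly_op[OF assms(1)])
  define K where "K = {a. 0 \<le> a \<and> (\<forall>x. - a * (norm x)\<^sup>2 \<le> inner (S x) x)}"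
  define a where "a = Inf K"
  have "- norm S * (norm x)\<^sup>2 \<le> inner (S x) x" for x
    using abs_inner_op_le[of S x] by simp
  then have "norm S \<in> K" by (simp add: K_def)
  then have ne: "K \<noteq> {}" by auto
  have bdd: "bdd_below K"
    by (rule bdd_belowI[of _ 0]) (simp add: K_def)
  have a0: "0 \<le> a"
    unfolding a_def by (rule cInf_greatest[OF ne]) (simp add: K_def)
  have a_le: "- a * (norm x)\<^sup>2 \<le> inner (S x) x" for x
  proof (cases "x = 0")
    case False
    have "- inner (S x) x / (norm x)\<^sup>2 \<le> a"
      unfolding a_def
    proof (rule cInf_greatest[OF ne])
      fix b assume "b \<in> K"
      then have "- b * (norm x)\<^sup>2 \<le> inner (S x) x" by (simp add: K_def)
      with False show "- inner (S x) x / (norm x)\<^sup>2 \<le> b"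
        by (subst pos_divide_le_eq) simp_all
    qed
    with False show ?thesis by (simp add: field_simps)
  qed simp
  have "a = 0"
  proof (rule ccontr)
    assume "a \<noteq> 0"
    with a0 have a: "0 < a" by simp
    have eq: "poly_op (P + [:a:]) T = S + a *\<^sub>R id_blinfun"
      by (simp add: poly_op_add poly_op_const S_def)
    \<comment> \<open>Nonconstancy of \<open>P\<close> excludes \<open>P = - a\<close>.\<close>
    have "P + [:a:] \<noteq> 0"
      using assms(2) by (metis add_eq_0_iff2 degree_minus degree_pCons_0 less_irrefl)
    moreover have "poly (P + [:a:]) t \<noteq> 0" if "t \<in> real_spectrum T" for t
      using assms(3)[OF that] a by simp
    ultimately have "invertible_op (S + a *\<^sub>R id_blinfun)"
      using invertible_poly_op[OF assms(1)] by (metis eq)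
    moreover have "0 \<le> inner ((S + a *\<^sub>R id_blinfun) x) x" for x
      using a_le[of x]
      by (simp add: blinfun.add_left blinfun.scaleR_left inner_add_left power2_norm_eq_inner)
    then have "positive_op (S + a *\<^sub>R id_blinfun)"
      using S by (simp add: positive_op_iff selfadjoint_op_add selfadjoint_op_scaleR)
    ultimately obtain d where d: "0 < d" "d * (norm x)\<^sup>2 \<le> inner ((S + a *\<^sub>R id_blinfun) x) x" for x
      using strictly_positive_coercive strictly_positive_op_def by blast
    \<comment> \<open>The cap at \<open>a\<close> keeps the new shift \<open>a - d'\<close>
      nonnegative, as membership in \<open>K\<close> demands.\<close>
    define d' where "d' = min d a"
    have "a - d' \<in> K"
      unfolding K_def
    proof (intro CollectI conjI allI)
      show "0 \<le> a - d'" by (simp add: d'_def)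
      show "- (a - d') * (norm x)\<^sup>2 \<le> inner (S x) x" for x
      proof -
        have "d' * (norm x)\<^sup>2 \<le> d * (norm x)\<^sup>2"
          by (intro mult_right_mono) (auto simp: d'_def)
        with d(2)[of x] show ?thesis
          by (simp add: blinfun.add_left blinfun.scaleR_left inner_add_left power2_norm_eq_inner
              algebra_simps)
      qed
    qed
    then have "a \<le> a - d'"
      using cInf_lower[OF _ bdd] by (simp only: a_def[symmetric])
    with a d(1) show False by (simp add: d'_def split: if_splits)
  qed
  with a_le[of x] show ?thesis by (simp add: S_def)
qed

text \<open>A constant \<open>P < 0\<close> is possible only if the spectrum is empty, hence every \<open>T - k\<close> is
  nonnegative and the space is trivial.\<close>

lemma poly_op_nonneg:
  assumes "selfadjoint_op T" "\<And>t. t \<in> real_spectrum T \<Longrightarrow> 0 \<le> poly P t"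
  shows "0 \<le> inner (poly_op P T x) x"
proof (cases "degree P = 0")
  case True
  then obtain a where a: "P = [:a:]" by (rule degree_eq_zeroE)
  show ?thesis
  proof (cases "0 \<le> a")
    case False
    with assms(2) a have "real_spectrum T = {}" by fastforce
    then have k: "0 \<le> inner (poly_op [:- k, 1:] T x) x" for k
      by (intro poly_op_nonneg_nonconst[OF assms(1)]) auto
    have "x = 0"
    proof (rule ccontr)
      assume "x \<noteq> 0"
      \<comment> \<open>This \<open>k\<close> makes the form of \<open>T - k\<close> at
        \<open>x\<close> equal to \<open>- 1\<close>.\<close>
      with k[of "(inner (T x) x + 1) / inner x x"] show False
        by (simp add: poly_op_pCons_apply inner_diff_left inner_add_left)
    qed
    then show ?thesis by simp
  qed (simp add: a poly_op_const blinfun.scaleR_left)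
qed (use assms poly_op_nonneg_nonconst in blast)

text \<open>\<open>K\<^sup>2 - P\<^sup>2\<close> is nonnegative on the spectrum, and by
  self-adjointness its form at \<open>x\<close> is the difference of the squared norms to be
  compared.\<close>

lemma norm_poly_op_le:
  assumes "selfadjoint_op T" "0 \<le> K" "\<And>t. t \<in> real_spectrum T \<Longrightarrow> \<bar>poly P t\<bar> \<le> K"
  shows "norm (poly_op P T) \<le> K"
proof (rule norm_blinfun_bound[OF assms(2)])
  fix x
  have "0 \<le> inner (poly_op ([:K\<^sup>2:] - P * P) T x) x"
  proof (rule poly_op_nonneg[OF assms(1)])
    fix t assume "t \<in> real_spectrum T"
    from power_mono[OF assms(3)[OF this] abs_ge_zero, of 2]
    show "0 \<le> poly ([:K\<^sup>2:] - P * P) t"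
      by (simp add: power2_eq_square)
  qed
  also have "\<dots> = (K * norm x)\<^sup>2 - (norm (poly_op P T x))\<^sup>2"
    using selfadjoint_opD(2)[OF selfadjoint_poly_op[OF assms(1)], of P "poly_op P T x" x]
    by (simp add: poly_op_diff poly_op_mult poly_op_const blinfun.diff_left blinfun.scaleR_left
        inner_diff_left power2_norm_eq_inner power_mult_distrib)
  finally have "(norm (poly_op P T x))\<^sup>2 \<le> (K * norm x)\<^sup>2" by simp
  then show "norm (poly_op P T x) \<le> K * norm x"
    by (rule power2_le_imp_le) (use assms(2) in simp)
qed

section \<open>Functional calculus\<close>

text \<open>The defining property of \<open>fun_calc\<close> as a relation, so that closure laws can
  be proved for arbitrary witnesses before existence and uniqueness are known.\<close>

definition is_fun_calc :: "(real \<Rightarrow> real) \<Rightarrow> ('a::chilbert_space \<Rightarrow>\<^sub>L 'a) \<Rightarrow> ('a \<Rightarrow>\<^sub>L 'a) \<Rightarrow> bool"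
  where "is_fun_calc f X Y \<longleftrightarrow> (\<forall>\<epsilon>>0. \<exists>P.
    (\<forall>t\<in>real_spectrum X. \<bar>poly P t - f t\<bar> < \<epsilon>) \<and> norm (poly_op P X - Y) < \<epsilon>)"

lemma is_fun_calcI:
  assumes "\<And>\<epsilon>. 0 < \<epsilon> \<Longrightarrow> \<exists>P. (\<forall>t\<in>real_spectrum X. \<bar>poly P t - f t\<bar> < \<epsilon>) \<and> norm (poly_op P X - Y) < \<epsilon>"
  shows "is_fun_calc f X Y"
  using assms by (auto simp: is_fun_calc_def)

lemma is_fun_calcE:
  assumes "is_fun_calc f X Y" "0 < \<epsilon>"
  obtains P where "\<And>t. t \<in> real_spectrum X \<Longrightarrow> \<bar>poly P t - f t\<bar> < \<epsilon>" "norm (poly_op P X - Y) < \<epsilon>"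
  using assms unfolding is_fun_calc_def by blast

lemma is_fun_calc_poly: "is_fun_calc (poly P) X (poly_op P X)"
  by (rule is_fun_calcI) (auto intro!: exI[of _ P])

lemma is_fun_calc_cong:
  assumes "is_fun_calc f X Y" "\<And>t. t \<in> real_spectrum X \<Longrightarrow> f t = g t"
  shows "is_fun_calc g X Y"
  using assms by (simp add: is_fun_calc_def)

text \<open>Choosing polynomials for the tolerances \<open>1 / (n + 1)\<close> reduces the closure
  laws to limit laws.\<close>

lemma is_fun_calc_seq:
  "is_fun_calc f X Y \<longleftrightarrow>
    (\<exists>P. (\<lambda>n. poly_op (P n) X) \<longlonglongrightarrow> Y \<and> uniform_limit (real_spectrum X) (\<lambda>n. poly (P n)) f sequentially)"
proof
  assume *: "is_fun_calc f X Y"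
  have "\<forall>n. \<exists>P. (\<forall>t\<in>real_spectrum X. \<bar>poly P t - f t\<bar> < inverse (real (Suc n))) \<and>
      norm (poly_op P X - Y) < inverse (real (Suc n))"
    using * by (auto simp: is_fun_calc_def)
  then obtain P where P: "\<And>n t. t \<in> real_spectrum X \<Longrightarrow> \<bar>poly (P n) t - f t\<bar> < inverse (real (Suc n))"
    "\<And>n. norm (poly_op (P n) X - Y) < inverse (real (Suc n))"
    by metis
  have ev: "\<forall>\<^sub>F n in sequentially. inverse (real (Suc n)) < e" if "0 < e" for e
    using order_tendstoD(2)[OF LIMSEQ_inverse_real_of_nat that] .
  have "(\<lambda>n. poly_op (P n) X) \<longlonglongrightarrow> Y"
    by (rule tendstoI, drule ev, erule eventually_mono) (metis P(2) dist_norm less_trans)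
  moreover have "uniform_limit (real_spectrum X) (\<lambda>n. poly (P n)) f sequentially"
    by (rule uniform_limitI, drule ev, erule eventually_mono) (metis P(1) dist_real_def less_trans)
  ultimately show "\<exists>P. (\<lambda>n. poly_op (P n) X) \<longlonglongrightarrow> Y \<and> uniform_limit (real_spectrum X) (\<lambda>n. poly (P n)) f sequentially"
    by blast
next
  assume "\<exists>P. (\<lambda>n. poly_op (P n) X) \<longlonglongrightarrow> Y \<and> uniform_limit (real_spectrum X) (\<lambda>n. poly (P n)) f sequentially"
  then obtain P where P: "(\<lambda>n. poly_op (P n) X) \<longlonglongrightarrow> Y" "uniform_limit (real_spectrum X) (\<lambda>n. poly (P n)) f sequentially"
    by blast
  show "is_fun_calc f X Y"
  proof (rule is_fun_calcI)
    fix \<epsilon> :: real assume "0 < \<epsilon>"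
    from eventually_conj[OF tendstoD[OF P(1) this] uniform_limitD[OF P(2) this]]
    obtain n where "dist (poly_op (P n) X) Y < \<epsilon>" "\<forall>t\<in>real_spectrum X. dist (poly (P n) t) (f t) < \<epsilon>"
      using eventually_happens by fastforce
    then show "\<exists>P. (\<forall>t\<in>real_spectrum X. \<bar>poly P t - f t\<bar> < \<epsilon>) \<and> norm (poly_op P X - Y) < \<epsilon>"
      by (auto simp: dist_norm)
  qed
qed


lemma is_fun_calc_add:
  assumes "is_fun_calc f X Y" "is_fun_calc g X Z"
  shows "is_fun_calc (\<lambda>t. f t + g t) X (Y + Z)"
proof -
  obtain P Q where "(\<lambda>n. poly_op (P n) X) \<longlonglongrightarrow> Y" "(\<lambda>n. poly_op (Q n) X) \<longlonglongrightarrow> Z"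
    and "uniform_limit (real_spectrum X) (\<lambda>n. poly (P n)) f sequentially"
    "uniform_limit (real_spectrum X) (\<lambda>n. poly (Q n)) g sequentially"
    using assms unfolding is_fun_calc_seq by blast
  then show ?thesis
    unfolding is_fun_calc_seq
    by (intro exI[of _ "\<lambda>n. P n + Q n"]) (simp add: poly_op_add poly_add[abs_def] tendsto_add uniform_limit_add)
qed

lemma is_fun_calc_scale:
  assumes "is_fun_calc f X Y"
  shows "is_fun_calc (\<lambda>t. r * f t) X (r *\<^sub>R Y)"
proof -
  obtain P where "(\<lambda>n. poly_op (P n) X) \<longlonglongrightarrow> Y"
    and "uniform_limit (real_spectrum X) (\<lambda>n. poly (P n)) f sequentially"
    using assms unfolding is_fun_calc_seq by blast
  then show ?thesis
    unfolding is_fun_calc_seq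
    by (intro exI[of _ "\<lambda>n. smult r (P n)"])
      (simp add: poly_op_smult poly_smult[abs_def] tendsto_scaleR
        bounded_linear.uniform_limit[OF bounded_linear_mult_right])
qed

lemma is_fun_calc_diff:
  assumes "is_fun_calc f X Y" "is_fun_calc g X Z"
  shows "is_fun_calc (\<lambda>t. f t - g t) X (Y - Z)"
  using is_fun_calc_add[OF assms(1) is_fun_calc_scale[OF assms(2), of "- 1"]] by simp

text \<open>On the spectrum, which lies in a compact interval, \<open>f\<close> stays within
  \<open>1\<close> of a polynomial. The bound serves \<open>is_fun_calc_mult\<close>, where uniform
  limits are multiplied.\<close>

lemma is_fun_calc_bounded:
  assumes "selfadjoint_op X" "is_fun_calc f X Y"
  shows "bounded (f ` real_spectrum X)"
proof -
  obtain P where P: "\<And>t. t \<in> real_spectrum X \<Longrightarrow> \<bar>poly P t - f t\<bar> < 1"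
    using is_fun_calcE[OF assms(2) zero_less_one] by blast
  have "- norm X * (norm x)\<^sup>2 \<le> inner (X x) x" "inner (X x) x \<le> norm X * (norm x)\<^sup>2" for x
    using abs_inner_op_le[of X x] by linarith+
  then have sub: "real_spectrum X \<subseteq> {- norm X..norm X}"
    by (rule real_spectrum_subset[OF assms(1)])
  have "compact (poly P ` {- norm X..norm X})"
    by (intro compact_continuous_image continuous_intros compact_Icc)
  then have "bounded (poly P ` {- norm X..norm X})"
    by (rule compact_imp_bounded)
  then obtain b where b: "\<forall>y\<in>poly P ` {- norm X..norm X}. norm y \<le> b"
    unfolding bounded_iff by blast
  have "norm (f t) \<le> b + 1" if t: "t \<in> real_spectrum X" for t
  proof -
    from b t sub have "\<bar>poly P t\<bar> \<le> b" by (simp add: subset_iff)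
    with P[OF t] show ?thesis
      unfolding real_norm_def by linarith
  qed
  then show ?thesis
    unfolding bounded_iff by blast
qed

lemma is_fun_calc_mult:
  assumes "selfadjoint_op X" "is_fun_calc f X Y" "is_fun_calc g X Z"
  shows "is_fun_calc (\<lambda>t. f t * g t) X (Y o\<^sub>L Z)"
proof -
  obtain P Q where "(\<lambda>n. poly_op (P n) X) \<longlonglongrightarrow> Y" "(\<lambda>n. poly_op (Q n) X) \<longlonglongrightarrow> Z"
    and "uniform_limit (real_spectrum X) (\<lambda>n. poly (P n)) f sequentially"
    "uniform_limit (real_spectrum X) (\<lambda>n. poly (Q n)) g sequentially"
    using assms(2,3) unfolding is_fun_calc_seq by blast
  moreover have "bounded (f ` real_spectrum X)" "bounded (g ` real_spectrum X)"
    using assms is_fun_calc_bounded by blast+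
  ultimately show ?thesis
    unfolding is_fun_calc_seq
    by (intro exI[of _ "\<lambda>n. P n * Q n"])
      (simp add: poly_op_mult poly_mult[abs_def] bounded_bilinear.tendsto[OF bounded_bilinear_blinfun_compose]
        bounded_bilinear.bounded_uniform_limit[OF bounded_bilinear_mult])
qed

lemma is_fun_calc_selfadjoint:
  assumes "selfadjoint_op X" "is_fun_calc f X Y"
  shows "selfadjoint_op Y"
proof -
  obtain P where P: "(\<lambda>n. poly_op (P n) X) \<longlonglongrightarrow> Y"
    using assms(2) unfolding is_fun_calc_seq by blast
  have lim: "(\<lambda>n. poly_op (P n) X x) \<longlonglongrightarrow> Y x" for x
    by (rule blinfun.tendsto[OF P tendsto_const])
  have "Y (z *\<^sub>C x) = z *\<^sub>C Y x" for z x
  proof (rule LIMSEQ_unique[OF lim])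
    have "(\<lambda>n. z *\<^sub>C poly_op (P n) X x) \<longlonglongrightarrow> z *\<^sub>C Y x"
      by (rule bounded_linear.tendsto[OF bounded_linear_scaleC lim])
    then show "(\<lambda>n. poly_op (P n) X (z *\<^sub>C x)) \<longlonglongrightarrow> z *\<^sub>C Y x"
      using selfadjoint_poly_op[OF assms(1)] by (simp add: selfadjoint_op_def clinear_op_def)
  qed
  moreover have "inner (Y x) y = inner x (Y y)" for x y
  proof (rule LIMSEQ_unique[OF tendsto_inner[OF lim tendsto_const]])
    show "(\<lambda>n. inner (poly_op (P n) X x) y) \<longlonglongrightarrow> inner x (Y y)"
      unfolding selfadjoint_opD(2)[OF selfadjoint_poly_op[OF assms(1)]]
      by (rule tendsto_inner[OF tendsto_const lim])
  qed
  ultimately show ?thesis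
    by (simp add: selfadjoint_op_def clinear_op_def)
qed

text \<open>A polynomial within \<open>e / 2\<close> of \<open>f\<close> becomes nonnegative on the
  spectrum after adding \<open>e / 2\<close>. The operator error costs another \<open>e / 2\<close>,
  and \<open>e\<close> then tends to \<open>0\<close>.\<close>

lemma is_fun_calc_positive:
  assumes "selfadjoint_op X" "is_fun_calc f X Y" "\<And>t. t \<in> real_spectrum X \<Longrightarrow> 0 \<le> f t"
  shows "positive_op Y"
proof -
  have eps: "0 \<le> inner (Y x) x + e * (norm x)\<^sup>2" if e: "0 < e" for e x
  proof -
    from e have "0 < e / 2" by simp
    then obtain P where P: "\<And>t. t \<in> real_spectrum X \<Longrightarrow> \<bar>poly P t - f t\<bar> < e / 2"
      "norm (poly_op P X - Y) < e / 2"
      using is_fun_calcE[OF assms(2)] by blast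
    have "0 \<le> inner (poly_op (P + [:e / 2:]) X x) x"
    proof (rule poly_op_nonneg[OF assms(1)])
      fix t assume "t \<in> real_spectrum X"
      from P(1)[OF this] assms(3)[OF this] have "0 \<le> poly P t + e / 2"
        by linarith
      then show "0 \<le> poly (P + [:e / 2:]) t"
        by simp
    qed
    also have "\<dots> = inner (Y x) x + inner ((poly_op P X - Y) x) x + e / 2 * (norm x)\<^sup>2"
      by (simp add: poly_op_add poly_op_const blinfun.add_left blinfun.diff_left blinfun.scaleR_left
          inner_add_left inner_diff_left power2_norm_eq_inner)
    also have "inner ((poly_op P X - Y) x) x \<le> e / 2 * (norm x)\<^sup>2"
      using abs_inner_op_le[of "poly_op P X - Y" x] mult_right_mono[of "norm (poly_op P X - Y)" "e / 2" "(norm x)\<^sup>2"] P(2)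
      by simp
    finally show ?thesis by simp
  qed
  have "0 \<le> a" if "\<And>e. 0 < e \<Longrightarrow> 0 \<le> a + e * b" for a b :: real
  proof (rule tendsto_lowerbound)
    show "((\<lambda>e. a + e * b) \<longlongrightarrow> a) (at_right 0)"
      by (auto intro!: tendsto_eq_intros)
    show "\<forall>\<^sub>F e in at_right 0. 0 \<le> a + e * b"
      using eventually_at_right_less[of "0::real"] by (rule eventually_mono) (rule that)
  qed simp
  from this[OF eps] show ?thesis
    using is_fun_calc_selfadjoint[OF assms(1,2)] by (simp add: positive_op_iff)
qed

text \<open>In the form at \<open>x + T x\<close> the mixed terms add up to
  \<open>2 * inner (T x) (T x)\<close>.\<close>

lemma selfadjoint_op_eq_zero:
  assumes "selfadjoint_op T" "\<And>x. inner (T x) x = 0"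
  shows "T = 0"
proof (rule blinfun_eqI)
  fix x
  have "inner (T x) (T x) = 0"
    using assms(2)[of "x + T x"] assms(2)[of x] assms(2)[of "T x"] selfadjoint_opD(2)[OF assms(1), of "T x" x]
    by (simp add: blinfun.add_right inner_add_left inner_add_right)
  then show "T x = blinfun_apply 0 x" by simp
qed

text \<open>Both differences of two candidates are calculus values of the zero function, hence
  positive.\<close>

lemma is_fun_calc_unique:
  assumes "selfadjoint_op X" "is_fun_calc f X Y" "is_fun_calc f X Z"
  shows "Y = Z"
proof -
  have pos: "positive_op (Y - Z)" "positive_op (Z - Y)"
    using is_fun_calc_diff[OF assms(2,3)] is_fun_calc_diff[OF assms(3,2)]
      is_fun_calc_positive[OF assms(1)] by auto
  have "inner ((Y - Z) x) x = 0" for x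
    using pos by (auto simp: positive_op_iff blinfun.diff_left inner_diff_left intro: antisym)
  with pos(1) have "Y - Z = 0"
    by (intro selfadjoint_op_eq_zero) (auto simp: positive_op_iff)
  then show ?thesis by simp
qed

section \<open>Existence of the calculus for continuous functions\<close>

lemma Weierstrass_poly:
  fixes f :: "real \<Rightarrow> real"
  assumes "continuous_on {a..b} f" "0 < e"
  obtains P where "\<And>t. t \<in> {a..b} \<Longrightarrow> \<bar>poly P t - f t\<bar> < e"
proof -
  obtain g where g: "real_polynomial_function g" "\<And>t. t \<in> {a..b} \<Longrightarrow> \<bar>f t - g t\<bar> < e"
    using Stone_Weierstrass_real_polynomial_function[OF compact_Icc assms] by blast
  then obtain c n where "g = (\<lambda>x. \<Sum>i\<le>n. c i * x ^ i)"
    by (auto simp: real_polynomial_function_iff_sum)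
  then have "poly (\<Sum>i\<le>n. monom (c i) i) t = g t" for t
    by (simp add: poly_sum poly_monom)
  with g(2) show thesis
    by (intro that[of "\<Sum>i\<le>n. monom (c i) i"]) (auto simp: abs_minus_commute)
qed

text \<open>Weierstrass polynomials are uniformly Cauchy on the spectrum, and
  \<open>norm_poly_op_le\<close> transfers this to the operators.\<close>

lemma is_fun_calc_exists:
  assumes "selfadjoint_op X" "real_spectrum X \<subseteq> {a..b}" "continuous_on {a..b} f"
  shows "\<exists>Y. is_fun_calc f X Y"
proof -
  have "\<exists>P. \<forall>t\<in>real_spectrum X. \<bar>poly P t - f t\<bar> < inverse (real (Suc n))" for n
    using Weierstrass_poly[OF assms(3), of "inverse (real (Suc n))"] assms(2)
    by (metis inverse_positive_iff_positive of_nat_0_less_iff subset_iff zero_less_Suc)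
  then obtain P where P: "\<And>n t. t \<in> real_spectrum X \<Longrightarrow> \<bar>poly (P n) t - f t\<bar> < inverse (real (Suc n))"
    by metis
  have unif: "uniform_limit (real_spectrum X) (\<lambda>n. poly (P n)) f sequentially"
  proof (rule uniform_limitI)
    fix e :: real assume "0 < e"
    then have "\<forall>\<^sub>F n in sequentially. inverse (real (Suc n)) < e"
      using order_tendstoD(2)[OF LIMSEQ_inverse_real_of_nat] by blast
    then show "\<forall>\<^sub>F n in sequentially. \<forall>t\<in>real_spectrum X. dist (poly (P n) t) (f t) < e"
      by (rule eventually_mono) (metis P dist_real_def less_trans)
  qed
  have "Cauchy (\<lambda>n. poly_op (P n) X)"
  proof (rule metric_CauchyI)
    fix e :: real assume e: "0 < e"
    \<comment> \<open>Two errors below \<open>e / 4\<close> bound the difference by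
      \<open>e / 2\<close>; the norm estimate is not strict, so slack below \<open>e\<close> is
      left.\<close>
    then obtain N where N: "\<And>n t. N \<le> n \<Longrightarrow> t \<in> real_spectrum X \<Longrightarrow> \<bar>poly (P n) t - f t\<bar> < e / 4"
      using uniform_limitD[OF unif, of "e / 4"] by (auto simp: eventually_sequentially dist_real_def)
    have "dist (poly_op (P m) X) (poly_op (P n) X) < e" if "N \<le> m" "N \<le> n" for m n
    proof -
      have "norm (poly_op (P m - P n) X) \<le> e / 2"
      proof (rule norm_poly_op_le[OF assms(1)])
        fix t assume "t \<in> real_spectrum X"
        from N[OF that(1) this] N[OF that(2) this] show "\<bar>poly (P m - P n) t\<bar> \<le> e / 2"
          unfolding poly_diff by linarith
      qed (use e in simp)
      with e show ?thesis by (simp add: dist_norm poly_op_diff)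
    qed
    then show "\<exists>M. \<forall>m\<ge>M. \<forall>n\<ge>M. dist (poly_op (P m) X) (poly_op (P n) X) < e"
      by blast
  qed
  then obtain Y where "(\<lambda>n. poly_op (P n) X) \<longlonglongrightarrow> Y"
    using Cauchy_convergent convergent_def by blast
  with unif show ?thesis
    unfolding is_fun_calc_seq by blast
qed

lemma is_fun_calc_fun_calc:
  assumes "selfadjoint_op X" "real_spectrum X \<subseteq> {a..b}" "continuous_on {a..b} f"
  shows "is_fun_calc f X (fun_calc f X)"
proof -
  have "fun_calc f X = (THE Y. is_fun_calc f X Y)"
    by (simp add: fun_calc_def is_fun_calc_def real_spectrum_def)
  moreover obtain Y where "is_fun_calc f X Y"
    using is_fun_calc_exists[OF assms] by blast
  ultimately show ?thesis
    using is_fun_calc_unique[OF assms(1)] by (metis theI)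
qed

section \<open>Relative operator entropies\<close>

lemma is_fun_calc_one: "is_fun_calc (\<lambda>t. 1) X id_blinfun"
  using is_fun_calc_cong[OF is_fun_calc_poly[of "[:1:]" X]] by (simp add: poly_op_const)

lemma is_fun_calc_ident: "is_fun_calc (\<lambda>t. t) X X"
  using is_fun_calc_cong[OF is_fun_calc_poly[of "[:0, 1:]" X]] by (simp add: poly_op_ident)

lemma selfadjoint_strictly_positive: "strictly_positive_op A \<Longrightarrow> selfadjoint_op A"
  by (simp add: strictly_positive_op_def positive_op_iff)

text \<open>A coercivity constant \<open>d > 0\<close> confines the spectrum to
  \<open>{d..norm A}\<close>, where every real power is continuous.\<close>

lemma is_fun_calc_powr_op:
  assumes "strictly_positive_op A"
  shows "is_fun_calc (\<lambda>t. t powr r) A (powr_op A r)"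
    and "\<And>t. t \<in> real_spectrum A \<Longrightarrow> 0 < t"
proof -
  obtain d where d: "0 < d" "\<And>x. d * (norm x)\<^sup>2 \<le> inner (A x) x"
    using strictly_positive_coercive[OF assms] by blast
  have sub: "real_spectrum A \<subseteq> {d..norm A}"
    using d(2) abs_le_D1[OF abs_inner_op_le]
    by (intro real_spectrum_subset selfadjoint_strictly_positive assms)
  then show "\<And>t. t \<in> real_spectrum A \<Longrightarrow> 0 < t"
    using d(1) by fastforce
  show "is_fun_calc (\<lambda>t. t powr r) A (powr_op A r)"
    unfolding powr_op_def
    using d(1) by (intro is_fun_calc_fun_calc[OF _ sub] selfadjoint_strictly_positive assms)
      (auto intro!: continuous_intros)
qed

lemma selfadjoint_powr_op:
  assumes "strictly_positive_op A"
  shows "selfadjoint_op (powr_op A r)"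
  by (rule is_fun_calc_selfadjoint[OF selfadjoint_strictly_positive is_fun_calc_powr_op(1)]) fact+

lemma powr_op_half_square:
  assumes "strictly_positive_op A"
  shows "powr_op A (1/2) o\<^sub>L powr_op A (1/2) = A"
proof (rule is_fun_calc_unique)
  show sa: "selfadjoint_op A"
    using assms by (rule selfadjoint_strictly_positive)
  have "is_fun_calc (\<lambda>t. t powr (1/2) * t powr (1/2)) A (powr_op A (1/2) o\<^sub>L powr_op A (1/2))"
    by (intro is_fun_calc_mult is_fun_calc_powr_op assms sa)
  then show "is_fun_calc (\<lambda>t. t) A (powr_op A (1/2) o\<^sub>L powr_op A (1/2))"
    by (rule is_fun_calc_cong) (simp add: is_fun_calc_powr_op(2)[OF assms] less_imp_le flip: powr_add)
  show "is_fun_calc (\<lambda>t. t) A A"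
    by (rule is_fun_calc_ident)
qed

lemma powr_op_neg_half_congruence:
  assumes "strictly_positive_op A"
  shows "powr_op A (-1/2) o\<^sub>L A o\<^sub>L powr_op A (-1/2) = id_blinfun"
proof (rule is_fun_calc_unique)
  show sa: "selfadjoint_op A"
    using assms by (rule selfadjoint_strictly_positive)
  have "is_fun_calc (\<lambda>t. t powr (-1/2) * t * t powr (-1/2)) A
      (powr_op A (-1/2) o\<^sub>L A o\<^sub>L powr_op A (-1/2))"
    by (intro is_fun_calc_mult is_fun_calc_powr_op is_fun_calc_ident assms sa)
  moreover have "t powr (-1/2) * t * t powr (-1/2) = 1" if "t \<in> real_spectrum A" for t
  proof -
    have t: "0 < t" using is_fun_calc_powr_op(2)[OF assms that] .
    have "t powr (-1/2) * t powr (-1/2) = t powr (-1)"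
      by (simp flip: powr_add)
    then have "(t powr (-1/2) * t powr (-1/2)) * t = 1"
      using t by (simp add: powr_minus)
    then show ?thesis by (simp only: mult_ac)
  qed
  ultimately show "is_fun_calc (\<lambda>t. 1) A (powr_op A (-1/2) o\<^sub>L A o\<^sub>L powr_op A (-1/2))"
    by (rule is_fun_calc_cong)
  show "is_fun_calc (\<lambda>t. 1) A id_blinfun"
    by (rule is_fun_calc_one)
qed

text \<open>Since \<open>S o\<^sub>L A o\<^sub>L S\<close> is the identity, evaluating the bounds
  between \<open>A\<close> and \<open>B\<close> at \<open>S x\<close> gives bounds on the form of
  \<open>rel_op A B\<close> at \<open>x\<close> by multiples of
  \<open>(norm x)\<^sup>2\<close>.\<close>

lemma rel_op_spectrum:
  assumes A: "strictly_positive_op A" and B: "strictly_positive_op B"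
    and u: "u *\<^sub>R A \<le>\<^sub>H B" and v: "B \<le>\<^sub>H v *\<^sub>R A"
  shows "selfadjoint_op (rel_op A B)" "real_spectrum (rel_op A B) \<subseteq> {u..v}"
proof -
  define S where "S = powr_op A (-1/2)"
  have S: "selfadjoint_op S"
    unfolding S_def by (rule selfadjoint_powr_op[OF A])
  have id: "S o\<^sub>L A o\<^sub>L S = id_blinfun"
    unfolding S_def by (rule powr_op_neg_half_congruence[OF A])
  have X: "rel_op A B = S o\<^sub>L B o\<^sub>L S"
    by (simp add: rel_op_def S_def)
  show sa: "selfadjoint_op (rel_op A B)"
    unfolding X by (intro selfadjoint_op_congruence S selfadjoint_strictly_positive B)
  have nA: "inner (A (S x)) (S x) = (norm x)\<^sup>2" for x
  proof -
    have "inner (A (S x)) (S x) = inner ((S o\<^sub>L A o\<^sub>L S) x) x"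
      using selfadjoint_opD(2)[OF S, of "A (S x)" x] by simp
    then show ?thesis
      by (simp add: id power2_norm_eq_inner)
  qed
  have nX: "inner (rel_op A B x) x = inner (B (S x)) (S x)" for x
    using selfadjoint_opD(2)[OF S, of "B (S x)" x] by (simp add: X)
  have le: "u * inner (A y) y \<le> inner (B y) y" "inner (B y) y \<le> v * inner (A y) y" for y
    using u v by (auto simp: le_op_def positive_op_iff blinfun.diff_left blinfun.scaleR_left
        inner_diff_left)
  show "real_spectrum (rel_op A B) \<subseteq> {u..v}"
    using le[of "S _"] by (intro real_spectrum_subset[OF sa]) (simp_all only: nA nX)
qed

text \<open>The \<open>A\<close> subtracted in \<open>tsallis_entropy\<close> is
  \<open>?R o\<^sub>L ?R\<close>, so it corresponds to the constant \<open>1\<close> inside the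
  calculus of \<open>?X\<close>.\<close>

lemma tsallis_minus_rel_entropy:
  assumes "strictly_positive_op A" "strictly_positive_op B" "0 < u" "u *\<^sub>R A \<le>\<^sub>H B" "B \<le>\<^sub>H v *\<^sub>R A"
  obtains E where "is_fun_calc (entropy_fun c r) (rel_op A B) E"
    and "tsallis_entropy r A B - c *\<^sub>R rel_entropy r A B =
      powr_op A (1/2) o\<^sub>L E o\<^sub>L powr_op A (1/2)"
proof -
  let ?X = "rel_op A B" and ?R = "powr_op A (1/2)"
  note X = rel_op_spectrum[OF assms(1,2,4,5)]
  \<comment> \<open>Because \<open>u > 0\<close>, both \<open>powr\<close> and \<open>ln\<close> are
    continuous on \<open>{u..v}\<close>.\<close>
  have P: "is_fun_calc (\<lambda>t. t powr r) ?X (powr_op ?X r)" and L: "is_fun_calc ln ?X (ln_op ?X)"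
    unfolding powr_op_def ln_op_def using assms(3)
    by (auto intro!: is_fun_calc_fun_calc[OF X] continuous_intros)
  define E where "E = inverse r *\<^sub>R (powr_op ?X r - id_blinfun) - c *\<^sub>R (powr_op ?X r o\<^sub>L ln_op ?X)"
  have "is_fun_calc (\<lambda>t. inverse r * (t powr r - 1) - c * (t powr r * ln t)) ?X E"
    unfolding E_def
    by (intro is_fun_calc_diff is_fun_calc_scale is_fun_calc_mult is_fun_calc_one P L X(1))
  then have "is_fun_calc (entropy_fun c r) ?X E"
    by (rule is_fun_calc_cong) (simp add: entropy_fun_def divide_inverse mult.commute)
  moreover have "?R (?R x) = A x" for x
    using arg_cong[OF powr_op_half_square[OF assms(1)], of "\<lambda>T. T x"] by simp
  then have "tsallis_entropy r A B - c *\<^sub>R rel_entropy r A B = ?R o\<^sub>L E o\<^sub>L ?R"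
    by (intro blinfun_eqI)
      (simp add: tsallis_entropy_def rel_entropy_def E_def blinfun.bilinear_simps)
  ultimately show thesis by (rule that)
qed

text \<open>Congruence by the self-adjoint square root of \<open>A\<close> preserves positivity of
  \<open>F - E\<close>, so a pointwise inequality on \<open>[u, v]\<close> suffices.\<close>

lemma entropy_le_op:
  assumes "strictly_positive_op A" "strictly_positive_op B" "0 < u" "u *\<^sub>R A \<le>\<^sub>H B" "B \<le>\<^sub>H v *\<^sub>R A"
    and "\<And>t. u \<le> t \<Longrightarrow> t \<le> v \<Longrightarrow> entropy_fun c p t \<le> entropy_fun c q t"
  shows "tsallis_entropy p A B - c *\<^sub>R rel_entropy p A B
    \<le>\<^sub>H tsallis_entropy q A B - c *\<^sub>R rel_entropy q A B"
proof -
  let ?R = "powr_op A (1/2)"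
  note X = rel_op_spectrum[OF assms(1,2,4,5)]
  obtain E where E: "is_fun_calc (entropy_fun c p) (rel_op A B) E"
    "tsallis_entropy p A B - c *\<^sub>R rel_entropy p A B = ?R o\<^sub>L E o\<^sub>L ?R"
    using tsallis_minus_rel_entropy[OF assms(1-5)] .
  obtain F where F: "is_fun_calc (entropy_fun c q) (rel_op A B) F"
    "tsallis_entropy q A B - c *\<^sub>R rel_entropy q A B = ?R o\<^sub>L F o\<^sub>L ?R"
    using tsallis_minus_rel_entropy[OF assms(1-5)] .
  have "positive_op (F - E)"
    using X(2) assms(6) by (intro is_fun_calc_positive[OF X(1) is_fun_calc_diff[OF F(1) E(1)]]) auto
  then have "positive_op (?R o\<^sub>L (F - E) o\<^sub>L ?R)"
    by (intro positive_op_congruence selfadjoint_powr_op assms(1))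
  also have "?R o\<^sub>L (F - E) o\<^sub>L ?R = (?R o\<^sub>L F o\<^sub>L ?R) - (?R o\<^sub>L E o\<^sub>L ?R)"
    by (intro blinfun_eqI) (simp add: blinfun.bilinear_simps)
  finally show ?thesis
    by (simp add: le_op_def E(2) F(2))
qed

theorem proposition3p6:
  fixes A B :: "'a::chilbert_space \<Rightarrow>\<^sub>L 'a" and u v c p q :: real
  assumes "strictly_positive_op A" and "strictly_positive_op B"
    and "u > 0" and "v > 0" and "u *\<^sub>R A \<le>\<^sub>H B" and "B \<le>\<^sub>H v *\<^sub>R A"
    and "p \<in> {-1..1} - {0}" and "q \<in> {-1..1} - {0}"
  shows
    "(0 < c \<and> c \<le> 1/2 \<and>
        ((u \<ge> 1 \<and> -1 \<le> p \<and> p \<le> q \<and> q < 0) \<or>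
         (v \<le> 1 \<and> 0 < p \<and> p \<le> q \<and> q \<le> 1) \<or>
         (1 \<le> u \<and> u \<le> v \<and> v \<le> exp ((1 - 2 * c) / (c * q)) \<and> 0 < p \<and> p \<le> q \<and> q \<le> 1) \<or>
         (exp ((1 - 2 * c) / (c * p)) \<le> u \<and> u \<le> v \<and> v \<le> 1 \<and> -1 \<le> p \<and> p \<le> q \<and> q < 0))
      \<longrightarrow> tsallis_entropy p A B - c *\<^sub>R rel_entropy p A B
            \<le>\<^sub>H tsallis_entropy q A B - c *\<^sub>R rel_entropy q A B)
     \<and>
     (c \<ge> 1/2 \<and>
        ((exp ((1 - 2 * c) / (c * q)) \<le> u \<and> u \<le> v \<and> v \<le> 1 \<and> 0 < p \<and> p \<le> q \<and> q \<le> 1) \<or>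
         (1 \<le> u \<and> u \<le> v \<and> v \<le> exp ((1 - 2 * c) / (c * p)) \<and> -1 \<le> p \<and> p \<le> q \<and> q < 0) \<or>
         (u \<ge> 1 \<and> 0 < p \<and> p \<le> q \<and> q \<le> 1) \<or>
         (v \<le> 1 \<and> -1 \<le> p \<and> p \<le> q \<and> q < 0))
      \<longrightarrow> tsallis_entropy q A B - c *\<^sub>R rel_entropy q A B
            \<le>\<^sub>H tsallis_entropy p A B - c *\<^sub>R rel_entropy p A B)
     \<and>
     (c \<le> 0 \<and> -1 \<le> p \<and> p \<le> q \<and> q \<le> 1
      \<longrightarrow> tsallis_entropy p A B - c *\<^sub>R rel_entropy p A B
            \<le>\<^sub>H tsallis_entropy q A B - c *\<^sub>R rel_entropy q A B)"
proof (intro conjI impI; elim conjE)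
  note le = entropy_le_op[OF assms(1,2,3,5,6)]
  show "tsallis_entropy p A B - c *\<^sub>R rel_entropy p A B
      \<le>\<^sub>H tsallis_entropy q A B - c *\<^sub>R rel_entropy q A B"
    if c: "0 < c" "c \<le> 1/2" and cases:
      "(u \<ge> 1 \<and> -1 \<le> p \<and> p \<le> q \<and> q < 0) \<or>
       (v \<le> 1 \<and> 0 < p \<and> p \<le> q \<and> q \<le> 1) \<or>
       (1 \<le> u \<and> u \<le> v \<and> v \<le> exp ((1 - 2 * c) / (c * q)) \<and> 0 < p \<and> p \<le> q \<and> q \<le> 1) \<or>
       (exp ((1 - 2 * c) / (c * p)) \<le> u \<and> u \<le> v \<and> v \<le> 1 \<and> -1 \<le> p \<and> p \<le> q \<and> q < 0)"
  proof (rule le, rule entropy_fun_mono)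
    \<comment> \<open>Each condition puts \<open>p\<close> and \<open>q\<close> on the same side of
      \<open>0\<close>, so the derivative argument never meets \<open>r = 0\<close>.\<close>
    show "p \<le> q" "0 < p \<or> q < 0" using cases by auto
  qed (use assms(3) slope_nonneg_of_exp_bounds[OF c assms(3) _ _ _ _ cases] in auto)
  show "tsallis_entropy q A B - c *\<^sub>R rel_entropy q A B
      \<le>\<^sub>H tsallis_entropy p A B - c *\<^sub>R rel_entropy p A B"
    if c: "1/2 \<le> c" and cases:
      "(exp ((1 - 2 * c) / (c * q)) \<le> u \<and> u \<le> v \<and> v \<le> 1 \<and> 0 < p \<and> p \<le> q \<and> q \<le> 1) \<or>
       (1 \<le> u \<and> u \<le> v \<and> v \<le> exp ((1 - 2 * c) / (c * p)) \<and> -1 \<le> p \<and> p \<le> q \<and> q < 0) \<or>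
       (u \<ge> 1 \<and> 0 < p \<and> p \<le> q \<and> q \<le> 1) \<or>
       (v \<le> 1 \<and> -1 \<le> p \<and> p \<le> q \<and> q < 0)"
  proof (rule le, rule entropy_fun_antimono)
    show "p \<le> q" "0 < p \<or> q < 0" using cases by auto
  qed (use assms(3) slope_nonpos_of_exp_bounds[OF c assms(3) _ _ _ _ cases] in auto)
  \<comment> \<open>For \<open>c \<le> 0\<close> the scalar inequality holds at every
    \<open>t > 0\<close>, also when \<open>p < 0 < q\<close>.\<close>
  show "tsallis_entropy p A B - c *\<^sub>R rel_entropy p A B
      \<le>\<^sub>H tsallis_entropy q A B - c *\<^sub>R rel_entropy q A B"
    if "c \<le> 0" "p \<le> q"
    using that assms by (intro le entropy_fun_le_nonpos_coeff) auto
qed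

end
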